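(* Let $\xi$ be a nonnegative random variable with a nondegenerate distribution, and let $\hat N(t)$ be the associated decoupled renewal process. Let $b\in(0,1)$. Assume that, for some $\varrho\in(0,1)$ and some function $\ell$ slowly varying at $\infty$, $H(t):=-\log\mathbb{P}\{\xi>t\}=t^\varrho\ell(t)$ for $t>0$, and that $$H(t+v(t))-H(t)=\varrho\, v(t)t^{-1}H(t)+o(v(t)t^{-1}H(t))+o(1),\quad t\to\infty$$ for any function $v$ satisfying $v(t)=o(t)$ as $t\to\infty$. Then $$\lim_{t\to\infty}\frac{-\log\mathbb{P}\{\hat N(t)=\lfloor b\mu^{-1}t\rfloor\}}{t^{\varrho+1}\ell(t)}=\frac{(1-b)^{\varrho+1}}{\mu(\varrho+1)},$$ where $\mu=\mathbb{E}[\xi]<\infty$.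
   Context: Decoupled renewal process: let $\xi_1,\xi_2,\ldots$ be independent copies of $\xi$ and $S_n=\xi_1+\ldots+\xi_n$, $n\ge 1$. Let $\hat S_1,\hat S_2,\ldots$ be independent random variables such that, for each $n\geq 1$, $\hat S_n$ has the same distribution as $S_n$. Put $\hat N(t):=\sum_{n\geq 1}\mathbf{1}_{\{\hat S_n\leq t\}}$ for $t\geq 0$. *)

theory Defs
  imports "HOL-Probability.Probability" "HOL-Library.Landau_Symbols"
begin

text \<open>As usual, a slowly varying function only has to be positive and measurable near infinity.\<close>

definition slowly_varying :: "(real \<Rightarrow> real) \<Rightarrow> bool" where
  "slowly_varying l \<longleftrightarrow>
     (\<exists>A. (\<forall>t\<ge>A. 0 < l t) \<and> set_borel_measurable borel {A..} l) \<and>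
     (\<forall>c>0. ((\<lambda>t. l (c * t) / l t) \<longlongrightarrow> 1) at_top)"

definition iid_copies :: "'a measure \<Rightarrow> ('a \<Rightarrow> real) \<Rightarrow> (nat \<Rightarrow> 'a \<Rightarrow> real) \<Rightarrow> bool" where
  "iid_copies M \<xi> X \<longleftrightarrow>
     prob_space.indep_vars M (\<lambda>_. borel) X {1..} \<and>
     (\<forall>n\<ge>1. distr M borel (X n) = distr M borel \<xi>)"

definition random_walk :: "(nat \<Rightarrow> 'a \<Rightarrow> real) \<Rightarrow> nat \<Rightarrow> 'a \<Rightarrow> real" where
  "random_walk X n \<omega> = (\<Sum>i=1..n. X i \<omega>)"

definition decoupled :: "'a measure \<Rightarrow> (nat \<Rightarrow> 'a \<Rightarrow> real) \<Rightarrow> (nat \<Rightarrow> 'a \<Rightarrow> real) \<Rightarrow> bool" where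
  "decoupled M S S' \<longleftrightarrow>
     prob_space.indep_vars M (\<lambda>_. borel) S' {1..} \<and>
     (\<forall>n\<ge>1. distr M borel (S' n) = distr M borel (S n))"

text \<open>The count takes values in the extended nonnegative reals, so that it is \<open>\<infinity>\<close> (rather than
  an arbitrary number) on the event that infinitely many of the \<open>S' n\<close>, \<open>n \<ge> 1\<close>, are at most \<open>t\<close>.\<close>

definition counting_process :: "(nat \<Rightarrow> 'a \<Rightarrow> real) \<Rightarrow> real \<Rightarrow> 'a \<Rightarrow> ennreal" where
  "counting_process S' t \<omega> = (\<Sum>n. indicator {\<omega>. S' (Suc n) \<omega> \<le> t} \<omega>)"

text \<open>Since \<open>ln 0 = 0\<close>, this is \<open>0\<close> instead of \<open>\<infinity>\<close> where the tail vanishes. A function that is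
  positive near infinity, such as \<open>t powr \<rho> * l t\<close> with \<open>l\<close> slowly varying, can only agree with it
  for all \<open>t > 0\<close> if the tail vanishes nowhere.\<close>

definition neg_log_tail :: "'a measure \<Rightarrow> ('a \<Rightarrow> real) \<Rightarrow> real \<Rightarrow> real" where
  "neg_log_tail M \<xi> t = - ln (measure M {\<omega> \<in> space M. \<xi> \<omega> > t})"

end

theory Submission
  imports Defs
begin

text \<open>Put \<open>q t n = P(S\<^sub>n > t)\<close> and \<open>k = \<lfloor>b t / \<mu>\<rfloor>\<close>. Since \<open>q\<close> increases in \<open>n\<close>, the cheapest way to have \<open>k\<close> terms
  below \<open>t\<close> is that exactly the first \<open>k\<close> are, so \<open>- ln P(N(t) = k)\<close> is the sum of \<open>- ln (q t n)\<close> over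
  \<open>k < n \<le> 2 t / \<mu>\<close> up to an error \<open>O(t)\<close>; the terms with \<open>n > 2 t / \<mu>\<close> contribute a bounded factor because
  \<open>1 - q t n\<close> decays geometrically there. By the principle of one big jump,
  \<open>- ln (q t \<lfloor>a t / \<mu>\<rfloor>) / H t\<close> tends to \<open>(1 - a) powr \<rho>\<close> for \<open>a < 1\<close> and to \<open>0\<close> for \<open>a > 1\<close>. The upper
  estimate of \<open>q\<close> uses exponential moments of \<open>\<xi>\<close> truncated at \<open>x = (1 - a) t\<close> with parameter
  \<open>(1 - \<delta>) H x / x\<close>, which stay bounded because \<open>H u / u\<close> is almost decreasing. Integrating the
  limit over \<open>a \<in> [b, 1]\<close> gives the constant.\<close>

section \<open>Monotone functions of regular variation\<close>

text \<open>Carries bounds along a grid \<open>c ^ k * u\<close> over to every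
  \<open>x \<ge> u\<close> by monotonicity.\<close>

lemma geometric_scale:
  fixes c y :: real
  assumes "1 < c" "1 \<le> y"
  obtains k :: nat where "c ^ k \<le> y" "y < c ^ Suc k"
proof -
  define k where "k = nat \<lfloor>log c y\<rfloor>"
  have nn: "0 \<le> log c y" using assms by simp
  have "real k \<le> log c y" "log c y < real (Suc k)"
    using nn unfolding k_def by linarith+
  then have "c powr real k \<le> y" "y < c powr real (Suc k)"
    using assms by (auto simp: le_log_iff log_less_iff)
  then show ?thesis using assms that[of k] by (simp only: powr_realpow)
qed

text \<open>Regular variation of index \<open>\<rho>\<close>, stated by ratios alone without the
  slowly varying factor. Monotonicity does the work of the uniform convergence theorem.\<close>

locale regular_growth =
  fixes H :: "real \<Rightarrow> real" and \<rho> :: real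
  assumes mono_H: "mono H"
    and rho: "0 < \<rho>" "\<rho> < 1"
    and H_pos: "\<forall>\<^sub>F t in at_top. 0 < H t"
    and H_ratio: "\<And>c. 0 < c \<Longrightarrow> ((\<lambda>t. H (c * t) / H t) \<longlongrightarrow> c powr \<rho>) at_top"
begin

text \<open>Upper Potter bound: \<open>H (c * t) \<le> c powr s * H t\<close> is iterated along
  powers of \<open>c\<close>, and the prefactor \<open>c powr s\<close> pays for the last incomplete
  step. \<open>c\<close> stays free because a constant close to \<open>1\<close> is wanted
  later.\<close>

lemma H_le_power:
  assumes c: "1 < c" and s: "\<rho> < s"
  shows "\<forall>\<^sub>F u in at_top. \<forall>x\<ge>u. H x \<le> c powr s * (x / u) powr s * H u"
proof -
  have "c powr \<rho> < c powr s" using c s by simp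
  then have "\<forall>\<^sub>F t in at_top. H (c * t) / H t < c powr s"
    using H_ratio[of c] c by (intro order_tendstoD(2)) auto
  with H_pos eventually_gt_at_top[of 0]
  have "\<forall>\<^sub>F t in at_top. 0 < t \<and> 0 < H t \<and> H (c * t) \<le> c powr s * H t"
    by eventually_elim (auto simp: field_simps)
  then obtain u0 where u0: "\<And>t. u0 \<le> t \<Longrightarrow> 0 < t \<and> 0 < H t \<and> H (c * t) \<le> c powr s * H t"
    by (auto simp: eventually_at_top_linorder)
  have "H x \<le> c powr s * (x / u) powr s * H u" if u: "u0 \<le> u" and ux: "u \<le> x" for u x
  proof -
    have up: "0 < u" "0 < H u" using u0 u by auto
    have it: "H (c ^ k * u) \<le> (c ^ k) powr s * H u" for k
    proof (induction k)
      case (Suc k)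
      have "u0 \<le> c ^ k * u"
        using u c up mult_right_mono[of 1 "c ^ k" u] one_le_power[of c k] by linarith
      then have "H (c * (c ^ k * u)) \<le> c powr s * H (c ^ k * u)" using u0 by blast
      also have "\<dots> \<le> c powr s * ((c ^ k) powr s * H u)"
        using Suc by (intro mult_left_mono) auto
      also have "\<dots> = (c ^ Suc k) powr s * H u" using c by (simp add: powr_mult)
      finally show ?case by (simp add: mult.assoc)
    qed auto
    obtain k where k: "c ^ k \<le> x / u" "x / u < c ^ Suc k"
      using geometric_scale[OF c, of "x / u"] ux up by (auto simp: field_simps)
    have "H x \<le> H (c ^ Suc k * u)"
      using k up by (intro monoD[OF mono_H]) (simp add: field_simps)
    also have "\<dots> \<le> (c * c ^ k) powr s * H u" using it[of "Suc k"] by simp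
    also have "\<dots> = c powr s * (c ^ k) powr s * H u" using c by (simp add: powr_mult)
    also have "\<dots> \<le> c powr s * (x / u) powr s * H u"
      using k up c s rho by (intro mult_right_mono mult_left_mono powr_mono2) auto
    finally show ?thesis .
  qed
  then show ?thesis by (auto simp: eventually_at_top_linorder)
qed

text \<open>Lower Potter bound by the same iteration. It only has to beat a logarithm, so the ratio
  is fixed at \<open>2\<close>.\<close>

lemma H_ge_power:
  assumes s: "0 < s" "s < \<rho>"
  shows "\<forall>\<^sub>F u in at_top. \<forall>x\<ge>u. (x / u) powr s * H u \<le> 2 powr s * H x"
proof -
  have "2 powr \<rho> > 2 powr s" using s by simp
  then have "\<forall>\<^sub>F t in at_top. H (2 * t) / H t > 2 powr s"
    using H_ratio[of 2] by (intro order_tendstoD(1)) auto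
  with H_pos eventually_gt_at_top[of 0]
  have "\<forall>\<^sub>F t in at_top. 0 < t \<and> 0 < H t \<and> H (2 * t) \<ge> 2 powr s * H t"
    by eventually_elim (auto simp: field_simps)
  then obtain u0 where u0: "\<And>t. u0 \<le> t \<Longrightarrow> 0 < t \<and> 0 < H t \<and> H (2 * t) \<ge> 2 powr s * H t"
    by (auto simp: eventually_at_top_linorder)
  have "(x / u) powr s * H u \<le> 2 powr s * H x" if u: "u0 \<le> u" and ux: "u \<le> x" for u x
  proof -
    have up: "0 < u" "0 < H u" using u0 u by auto
    have it: "(2 ^ k) powr s * H u \<le> H (2 ^ k * u)" for k
    proof (induction k)
      case (Suc k)
      have "u0 \<le> 2 ^ k * u"
        using u up mult_right_mono[of 1 "2 ^ k" u] one_le_power[of "2::real" k] by linarith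
      then have "2 powr s * H (2 ^ k * u) \<le> H (2 * (2 ^ k * u))" using u0 by blast
      moreover have "2 powr s * ((2 ^ k) powr s * H u) \<le> 2 powr s * H (2 ^ k * u)"
        using Suc by (intro mult_left_mono) auto
      ultimately have "2 powr s * ((2 ^ k) powr s * H u) \<le> H (2 * (2 ^ k * u))" by linarith
      then show ?case by (simp add: powr_mult mult.assoc)
    qed auto
    obtain k where k: "2 ^ k \<le> x / u" "x / u < 2 ^ Suc k"
      using geometric_scale[of 2 "x / u"] ux up by (auto simp: field_simps)
    have "(x / u) powr s * H u \<le> (2 * 2 ^ k) powr s * H u"
      using k up s ux by (intro mult_right_mono powr_mono2) auto
    also have "\<dots> = 2 powr s * ((2 ^ k) powr s * H u)" by (simp add: powr_mult)
    also have "\<dots> \<le> 2 powr s * H (2 ^ k * u)" using it by (intro mult_left_mono) auto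
    also have "\<dots> \<le> 2 powr s * H x"
      using k up by (intro mult_left_mono monoD[OF mono_H]) (auto simp: field_simps)
    finally show ?thesis .
  qed
  then show ?thesis by (auto simp: eventually_at_top_linorder)
qed

text \<open>The upper Potter bound with an exponent between \<open>\<rho>\<close> and
  \<open>1\<close> makes \<open>H\<close> sublinear. Hence exponential parameters of order
  \<open>H x / x\<close> tend to \<open>0\<close>.\<close>

lemma H_over_id: "((\<lambda>t. H t / t) \<longlongrightarrow> 0) at_top"
proof -
  define s where "s = (1 + \<rho>) / 2"
  have s: "\<rho> < s" "s < 1" using rho by (auto simp: s_def)
  from eventually_conj[OF H_le_power[of 2, OF _ s(1)] eventually_gt_at_top[of 0]]
  obtain u where u: "0 < u" "\<And>x. u \<le> x \<Longrightarrow> H x \<le> 2 powr s * (x / u) powr s * H u"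
    by (auto simp: eventually_at_top_linorder)
  define C where "C = 2 powr s * H u / u powr s"
  have "\<forall>\<^sub>F t in at_top. H t / t \<le> C * t powr (s - 1)"
    using eventually_ge_at_top[of u]
  proof eventually_elim
    case (elim t)
    then show ?case using u(2)[OF elim] u(1)
      by (simp add: C_def powr_divide powr_diff field_simps)
  qed
  moreover have "\<forall>\<^sub>F t in at_top. 0 \<le> H t / t"
    using H_pos eventually_gt_at_top[of 0] by eventually_elim auto
  moreover have "((\<lambda>t. C * t powr (s - 1)) \<longlongrightarrow> 0) at_top"
    using tendsto_mult_right_zero[OF tendsto_neg_powr[OF _ filterlim_ident, of "s - 1"], of C] s by simp
  ultimately show ?thesis
    by - (rule tendsto_sandwich[OF _ _ tendsto_const])
qed

text \<open>\<open>H\<close> dominates a positive power of \<open>t\<close>, so polynomial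
  prefactors do not show on the scale \<open>exp (- H t)\<close>.\<close>

lemma ln_over_H: "((\<lambda>t. ln t / H t) \<longlongrightarrow> 0) at_top"
proof -
  define s where "s = \<rho> / 2"
  have s: "0 < s" "s < \<rho>" using rho by (auto simp: s_def)
  from eventually_conj[OF H_pos eventually_conj[OF H_ge_power[OF s] eventually_gt_at_top[of 0]]]
  obtain u where u: "0 < u" "0 < H u" "\<And>x. u \<le> x \<Longrightarrow> (x / u) powr s * H u \<le> 2 powr s * H x"
    by (auto simp: eventually_at_top_linorder)
  define C where "C = 2 powr s * u powr s / H u"
  have "\<forall>\<^sub>F t in at_top. ln t / H t \<le> C * (2 / s) * t powr - (s / 2)"
    using eventually_ge_at_top[of u] eventually_ge_at_top[of 1] H_pos
  proof eventually_elim
    case (elim t)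
    have "t powr s \<le> C * H t"
      using u(3)[OF elim(1)] u(1,2) elim by (simp add: C_def powr_divide field_simps)
    then have "ln t / H t \<le> C * (ln t / t powr s)"
      using elim mult_left_mono[of "t powr s" "C * H t" "ln t"] by (simp add: field_simps)
    \<comment> \<open>Half of the exponent absorbs the logarithm, the other half is left for
      decay.\<close>
    also have "\<dots> \<le> C * (t powr (s / 2) / (s / 2) / t powr s)"
      using elim s u by (intro mult_left_mono divide_right_mono ln_powr_bound) (auto simp: C_def)
    also have "\<dots> = C * (2 / s) * (t powr (s / 2) / t powr s)" by simp
    also have "t powr (s / 2) / t powr s = t powr - (s / 2)"
      by (simp flip: powr_diff)
    finally show ?case .
  qed
  moreover have "\<forall>\<^sub>F t in at_top. 0 \<le> ln t / H t"
    using H_pos eventually_ge_at_top[of 1] by eventually_elim auto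
  moreover have "((\<lambda>t. C * (2 / s) * t powr - (s / 2)) \<longlongrightarrow> 0) at_top"
    using s by (intro tendsto_mult_right_zero tendsto_neg_powr filterlim_ident) simp
  ultimately show ?thesis
    by - (rule tendsto_sandwich[OF _ _ tendsto_const])
qed

lemma H_at_top: "filterlim H at_top at_top"
proof -
  have "\<forall>\<^sub>F t in at_top. ln t / H t < 1"
    using order_tendstoD(2)[OF ln_over_H, of 1] by simp
  with H_pos have "\<forall>\<^sub>F t in at_top. ln t \<le> H t"
    by eventually_elim (simp add: field_simps)
  then show ?thesis by (rule filterlim_at_top_mono[OF ln_at_top])
qed

end

section \<open>Moments and exponential bounds for the random walk\<close>

text \<open>\<open>tail_pos\<close> makes \<open>H_eq\<close> faithful: with a vanishing tail,
  \<open>ln 0 = 0\<close> would hide an infinite cost.\<close>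

locale heavy_walk = prob_space M + regular_growth H \<rho>
  for M :: "'a measure" and H :: "real \<Rightarrow> real" and \<rho> :: real +
  fixes \<xi> :: "'a \<Rightarrow> real" and X :: "nat \<Rightarrow> 'a \<Rightarrow> real"
  assumes xi_meas [measurable]: "\<xi> \<in> borel_measurable M"
    and xi_nonneg: "AE \<omega> in M. 0 \<le> \<xi> \<omega>"
    and copies: "iid_copies M \<xi> X"
    and tail_pos: "\<And>t. 0 < prob {\<omega> \<in> space M. t < \<xi> \<omega>}"
    and H_eq: "\<And>t. H t = - ln (prob {\<omega> \<in> space M. t < \<xi> \<omega>})"
begin

abbreviation S :: "nat \<Rightarrow> 'a \<Rightarrow> real" where
  "S \<equiv> random_walk X"

definition \<mu> :: real where
  "\<mu> = expectation \<xi>"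

lemma tail_eq: "prob {\<omega> \<in> space M. t < \<xi> \<omega>} = exp (- H t)"
  using tail_pos[of t] by (simp add: H_eq)

lemma H_nonneg: "0 \<le> H t"
  using tail_pos[of t] by (simp add: H_eq)

lemma H_borel [measurable]: "H \<in> borel_measurable borel"
  by (rule borel_measurable_mono[OF mono_H])

lemma X_indep: "indep_vars (\<lambda>_. borel) X {1..}"
  using copies by (simp add: iid_copies_def)

lemma X_meas: "1 \<le> n \<Longrightarrow> X n \<in> borel_measurable M"
  using X_indep by (auto simp: indep_vars_def)

lemma X_distr: "1 \<le> n \<Longrightarrow> distr M borel (X n) = distr M borel \<xi>"
  using copies by (simp add: iid_copies_def)

lemma S_meas [measurable]: "S n \<in> borel_measurable M"
  unfolding random_walk_def by (intro borel_measurable_sum X_meas) auto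

lemma X_nonneg: "1 \<le> n \<Longrightarrow> AE \<omega> in M. 0 \<le> X n \<omega>"
proof -
  assume n: "1 \<le> n"
  have "AE x in distr M borel \<xi>. 0 \<le> x"
    using xi_nonneg by (subst AE_distr_iff) auto
  then have "AE x in distr M borel (X n). 0 \<le> x" unfolding X_distr[OF n] .
  then show ?thesis using X_meas[OF n] by (subst (asm) AE_distr_iff) auto
qed

lemma X_tail: "1 \<le> n \<Longrightarrow> prob {\<omega> \<in> space M. t < X n \<omega>} = exp (- H t)"
proof -
  assume n: "1 \<le> n"
  have "measure (distr M borel (X n)) {t<..} = measure (distr M borel \<xi>) {t<..}"
    using X_distr[OF n] by simp
  then have "prob (X n -` {t<..} \<inter> space M) = prob (\<xi> -` {t<..} \<inter> space M)"
    using X_meas[OF n] by (simp add: measure_distr)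
  moreover have "X n -` {t<..} \<inter> space M = {\<omega> \<in> space M. t < X n \<omega>}"
    "\<xi> -` {t<..} \<inter> space M = {\<omega> \<in> space M. t < \<xi> \<omega>}" by auto
  ultimately show ?thesis by (simp add: tail_eq)
qed

text \<open>Cutting the range of \<open>\<xi>\<close> into unit cells bounds \<open>f (\<xi> \<omega>)\<close>, for monotone \<open>f\<close>, by a sum over
  tail events. Unlike a computation through the law of \<open>H (\<xi> \<omega>)\<close>, this does not need continuity
  of the tail.\<close>

lemma exp_moment:
  assumes th: "0 \<le> \<theta>" "\<theta> < 1"
  shows "integrable M (\<lambda>\<omega>. (\<xi> \<omega>)\<^sup>2 * exp (\<theta> * H (\<xi> \<omega>)))"
proof -
  define f where "f y = y\<^sup>2 * exp (\<theta> * H y)" for y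
  have f_mono: "f y \<le> f z" if "0 \<le> y" "y \<le> z" for y z
    using that th monoD[OF mono_H that(2)] unfolding f_def
    by (intro mult_mono power_mono) (auto intro!: mult_left_mono)
  have f_nonneg: "0 \<le> f y" for y by (simp add: f_def)
  \<comment> \<open>Chosen with \<open>1 < c\<close> and \<open>\<theta> * c < 1\<close>: crossing a
    unit cell multiplies \<open>H\<close> by at most \<open>c\<close>, which leaves the decay
    \<open>exp (- d * H t)\<close>.\<close>
  define c where "c = 2 / (1 + \<theta>)"
  have c: "1 < c" "\<theta> * c < 1" using th by (auto simp: c_def field_simps)
  define d where "d = 1 - \<theta> * c"
  have d: "0 < d" using c by (simp add: d_def)
  have "c powr \<rho> < c powr 1" using c rho by (intro powr_less_mono) auto
  then have "\<forall>\<^sub>F t in at_top. H (c * t) / H t < c"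
    using H_ratio[of c] c by (intro order_tendstoD(2)) auto
  \<comment> \<open>Gives \<open>exp (- d * H t) \<le> t powr - 4\<close>: two powers cancel the
    square, two make the series converge.\<close>
  moreover have "\<forall>\<^sub>F t in at_top. ln t / H t < d / 4"
    using order_tendstoD(2)[OF ln_over_H, of "d / 4"] d by simp
  ultimately have "\<forall>\<^sub>F t in at_top. f (t + 1) * exp (- H t) \<le> 4 * t powr - 2"
    using H_pos eventually_ge_at_top[of 1] eventually_ge_at_top[of "1 / (c - 1)"]
  proof eventually_elim
    case (elim t)
    have "t + 1 \<le> c * t" using elim c by (simp add: field_simps)
    then have "H (t + 1) \<le> H (c * t)" by (rule monoD[OF mono_H])
    also have "\<dots> \<le> c * H t" using elim by (simp add: field_simps)
    finally have "\<theta> * H (t + 1) \<le> \<theta> * (c * H t)" using th by (intro mult_left_mono)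
    then have "\<theta> * H (t + 1) - H t \<le> - (d * H t)" by (simp add: d_def algebra_simps)
    also have "\<dots> \<le> - 4 * ln t" using elim by (simp add: field_simps)
    finally have "exp (\<theta> * H (t + 1) - H t) \<le> t powr - 4"
      using elim by (simp add: powr_def)
    then have "(t + 1)\<^sup>2 * exp (\<theta> * H (t + 1) - H t) \<le> (2 * t)\<^sup>2 * t powr - 4"
      using elim by (intro mult_mono power_mono) auto
    also have "\<dots> = 4 * (t powr 2 * t powr - 4)" using elim by (simp add: power2_eq_square powr_numeral)
    also have "t powr 2 * t powr - 4 = t powr - 2" by (simp flip: powr_add)
    finally show ?case by (simp add: f_def exp_diff exp_minus field_simps)
  qed
  then have "\<forall>\<^sub>F j in sequentially. norm (f (real j + 1) * exp (- H (real j))) \<le> 4 * real j powr - 2"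
    using filterlim_real_sequentially by (auto simp: filterlim_iff f_nonneg abs_mult)
  then have summ: "summable (\<lambda>j. f (real j + 1) * exp (- H (real j)))"
    by (rule summable_comparison_test_ev) (simp add: summable_real_powr_iff)
  have ennreal_suminf_ge_term: "F j \<le> (\<Sum>j. F j)" for F :: "nat \<Rightarrow> ennreal" and j
    using sum_le_suminf[of F "{j}"] by simp
  \<comment> \<open>Half lines instead of cells turn the expectations into tail probabilities. The
    summand \<open>f 0\<close> covers \<open>y = 0\<close>, which lies in no cell
    \<open>{j<..j + 1}\<close>.\<close>
  define g where "g y = ennreal (f 0) + (\<Sum>j. ennreal (f (real j + 1)) * indicator {real j<..} y)" for y
  have f_le: "ennreal (f y) \<le> g y" if y: "0 \<le> y" for y
  proof (cases "y = 0")
    case True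
    then show ?thesis by (simp add: g_def)
  next
    case False
    define j where "j = nat (\<lceil>y\<rceil> - 1)"
    have j: "real j < y" "y \<le> real j + 1" using y False unfolding j_def by linarith+
    have "ennreal (f y) \<le> ennreal (f (real j + 1)) * indicator {real j<..} y"
      using j y by (auto intro!: ennreal_leI f_mono)
    also have "\<dots> \<le> (\<Sum>j. ennreal (f (real j + 1)) * indicator {real j<..} y)"
      by (rule ennreal_suminf_ge_term)
    finally show ?thesis unfolding g_def by (simp add: add_increasing)
  qed
  have "(\<integral>\<^sup>+\<omega>. ennreal (f (\<xi> \<omega>)) \<partial>M) \<le> (\<integral>\<^sup>+\<omega>. g (\<xi> \<omega>) \<partial>M)"
    using xi_nonneg by (intro nn_integral_mono_AE) (auto intro: f_le)
  also have "\<dots> = ennreal (f 0) + (\<Sum>j. \<integral>\<^sup>+\<omega>. ennreal (f (real j + 1)) * indicator {real j<..} (\<xi> \<omega>) \<partial>M)"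
    unfolding g_def by (subst nn_integral_add) (auto simp: nn_integral_suminf emeasure_space_1)
  also have "(\<lambda>j. \<integral>\<^sup>+\<omega>. ennreal (f (real j + 1)) * indicator {real j<..} (\<xi> \<omega>) \<partial>M)
      = (\<lambda>j. ennreal (f (real j + 1) * exp (- H (real j))))"
  proof
    fix j
    have "(\<integral>\<^sup>+\<omega>. ennreal (f (real j + 1)) * indicator {real j<..} (\<xi> \<omega>) \<partial>M)
      = (\<integral>\<^sup>+\<omega>. ennreal (f (real j + 1)) * indicator {\<omega> \<in> space M. real j < \<xi> \<omega>} \<omega> \<partial>M)"
      by (intro nn_integral_cong) (auto simp: indicator_def)
    also have "\<dots> = ennreal (f (real j + 1)) * emeasure M {\<omega> \<in> space M. real j < \<xi> \<omega>}"
      by (intro nn_integral_cmult_indicator) measurable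
    also have "\<dots> = ennreal (f (real j + 1) * exp (- H (real j)))"
      by (simp add: emeasure_eq_measure tail_eq ennreal_mult f_nonneg)
    finally show "(\<integral>\<^sup>+\<omega>. ennreal (f (real j + 1)) * indicator {real j<..} (\<xi> \<omega>) \<partial>M)
      = ennreal (f (real j + 1) * exp (- H (real j)))" .
  qed
  also have "(\<Sum>j. ennreal (f (real j + 1) * exp (- H (real j))))
      = ennreal (\<Sum>j. f (real j + 1) * exp (- H (real j)))"
    by (intro suminf_ennreal2 summ) (simp add: f_nonneg)
  also have "ennreal (f 0) + \<dots> < \<infinity>" by simp
  finally show ?thesis
    by (intro integrableI_nonneg) (auto simp: f_def)
qed

lemma xi_square_integrable: "integrable M (\<lambda>\<omega>. (\<xi> \<omega>)\<^sup>2)"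
  using exp_moment[of 0] by simp

lemma xi_integrable: "integrable M \<xi>"
  by (rule square_integrable_imp_integrable[OF _ xi_square_integrable]) simp

lemma mu_pos: "0 < \<mu>"
proof -
  have "exp (- H 1) = expectation (indicator {\<omega> \<in> space M. 1 < \<xi> \<omega>})"
    by (simp add: tail_eq)
  also have "\<dots> \<le> expectation \<xi>"
    using xi_nonneg
    by (intro integral_mono_AE xi_integrable) (auto simp: indicator_def less_top[symmetric] elim!: eventually_mono)
  finally show ?thesis unfolding \<mu>_def by (rule less_le_trans[rotated]) simp
qed

section \<open>Exponential Markov bounds and lower deviations\<close>

text \<open>The indicator of \<open>A\<close> is dominated by a product of independent factors. The
  weight \<open>h\<close> is general because it is used both as a decaying exponential and as a
  truncated growing one.\<close>

lemma chernoff: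
  assumes h: "h \<in> borel_measurable borel" "\<And>y. 0 \<le> h y" "integrable M (\<lambda>\<omega>. h (\<xi> \<omega>))"
    and A: "A \<in> events" "\<And>\<omega>. \<omega> \<in> A \<Longrightarrow> 1 \<le> C * (\<Prod>i=1..n. h (X i \<omega>))" "0 \<le> C"
  shows "prob A \<le> C * expectation (\<lambda>\<omega>. h (\<xi> \<omega>)) ^ n"
proof -
  note [measurable] = h(1)
  have dist: "integrable M (\<lambda>\<omega>. h (X i \<omega>))" "expectation (\<lambda>\<omega>. h (X i \<omega>)) = expectation (\<lambda>\<omega>. h (\<xi> \<omega>))"
    if i: "1 \<le> i" for i
  proof -
    note [measurable] = X_meas[OF i]
    have "integrable (distr M borel (X i)) h"
      using h(3) unfolding X_distr[OF i] by (subst integrable_distr_eq) auto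
    then show "integrable M (\<lambda>\<omega>. h (X i \<omega>))" by (subst (asm) integrable_distr_eq) auto
    have "integral\<^sup>L (distr M borel (X i)) h = integral\<^sup>L (distr M borel \<xi>) h"
      by (simp add: X_distr[OF i])
    then show "expectation (\<lambda>\<omega>. h (X i \<omega>)) = expectation (\<lambda>\<omega>. h (\<xi> \<omega>))"
      by (simp add: integral_distr)
  qed
  have ind: "indep_vars (\<lambda>_. borel) (\<lambda>i \<omega>. h (X i \<omega>)) {1..n}"
    using h(1) by (intro indep_vars_compose2[OF indep_vars_subset[OF X_indep]]) auto
  have int: "integrable M (\<lambda>\<omega>. \<Prod>i=1..n. h (X i \<omega>))"
    using ind dist(1) by (intro indep_vars_integrable) auto
  have "prob A = expectation (indicator A)" using A(1) by simp
  also have "\<dots> \<le> expectation (\<lambda>\<omega>. C * (\<Prod>i=1..n. h (X i \<omega>)))"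
    using A h(2) int
    by (intro integral_mono) (auto simp: indicator_def less_top[symmetric] intro!: mult_nonneg_nonneg prod_nonneg)
  also have "\<dots> = C * (\<Prod>i=1..n. expectation (\<lambda>\<omega>. h (X i \<omega>)))"
    using ind dist(1) by (subst indep_vars_lebesgue_integral[symmetric]) auto
  also have "\<dots> = C * expectation (\<lambda>\<omega>. h (\<xi> \<omega>)) ^ n" using dist(2) by simp
  finally show ?thesis .
qed

text \<open>For a nonnegative variable, a finite second moment already gives geometric decay of
  lower deviations, through the Laplace transform at \<open>- s\<close>.\<close>

lemma lower_tail:
  assumes c: "c < \<mu>"
  obtains r where "0 < r" "r < 1" "\<And>n. prob {\<omega> \<in> space M. S n \<omega> \<le> c * n} \<le> r ^ n"
proof -
  define m2 where "m2 = expectation (\<lambda>\<omega>. (\<xi> \<omega>)\<^sup>2) + 1"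
  have m2: "0 < m2" by (auto simp: m2_def intro!: add_nonneg_pos)
  \<comment> \<open>The minimiser of \<open>s\<^sup>2 / 2 * m2 - s * (\<mu> - c)\<close>; the
    minimum is the exponent in \<open>r\<close> below.\<close>
  define s where "s = (\<mu> - c) / m2"
  have s: "0 < s" using c m2 by (simp add: s_def)
  \<comment> \<open>Clipping at \<open>0\<close> bounds \<open>h\<close> by \<open>1\<close>
    everywhere; nonnegativity of the summands is then carried inside the event
    \<open>?A\<close>.\<close>
  define h where "h y = exp (- s * max 0 y)" for y :: real
  define e where "e = expectation (\<lambda>\<omega>. h (\<xi> \<omega>))"
  have h_int: "integrable M (\<lambda>\<omega>. h (\<xi> \<omega>))"
    using s by (intro integrable_const_bound[of _ 1]) (auto simp: h_def)
  have exp_le: "exp (- y) \<le> 1 - y + y\<^sup>2 / 2" if "0 \<le> y" for y :: real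
  proof -
    \<comment> \<open>The product equals \<open>1 + y ^ 4 / 4\<close>.\<close>
    have "1 \<le> (1 - y + y\<^sup>2 / 2) * (1 + y + y\<^sup>2 / 2)"
      using that by (simp add: algebra_simps power2_eq_square)
    also have "\<dots> \<le> (1 - y + y\<^sup>2 / 2) * exp y"
    proof (intro mult_left_mono exp_lower_Taylor_quadratic that)
      have "0 \<le> ((y - 1)\<^sup>2 + 1) / 2" by simp
      then show "0 \<le> 1 - y + y\<^sup>2 / 2" by (simp add: power2_eq_square algebra_simps)
    qed
    finally show ?thesis by (simp only: exp_minus inverse_eq_divide pos_divide_le_eq[OF exp_gt_zero])
  qed
  have "e \<le> expectation (\<lambda>\<omega>. 1 - s * \<xi> \<omega> + s\<^sup>2 / 2 * (\<xi> \<omega>)\<^sup>2)"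
    unfolding e_def
  proof (intro integral_mono_AE h_int)
    show "integrable M (\<lambda>\<omega>. 1 - s * \<xi> \<omega> + s\<^sup>2 / 2 * (\<xi> \<omega>)\<^sup>2)"
      using xi_integrable xi_square_integrable by auto
    show "AE \<omega> in M. h (\<xi> \<omega>) \<le> 1 - s * \<xi> \<omega> + s\<^sup>2 / 2 * (\<xi> \<omega>)\<^sup>2"
      using xi_nonneg
    proof eventually_elim
      case (elim \<omega>)
      then show ?case using exp_le[of "s * \<xi> \<omega>"] s by (simp add: h_def power_mult_distrib)
    qed
  qed
  also have "\<dots> = 1 - s * \<mu> + s\<^sup>2 / 2 * (m2 - 1)"
    using xi_integrable xi_square_integrable by (simp add: \<mu>_def m2_def prob_space)
  also have "\<dots> \<le> 1 + (s\<^sup>2 / 2 * m2 - s * \<mu>)" by (simp add: algebra_simps)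
  also have "\<dots> \<le> exp (s\<^sup>2 / 2 * m2 - s * \<mu>)" by (rule exp_ge_add_one_self)
  finally have e: "e \<le> exp (s\<^sup>2 / 2 * m2 - s * \<mu>)" .
  define r where "r = exp (- (s * (\<mu> - c) / 2))"
  have "exp (s * c) * e \<le> exp (s * c) * exp (s\<^sup>2 / 2 * m2 - s * \<mu>)"
    using e by (intro mult_left_mono) auto
  also have "\<dots> = r"
    using m2 by (simp add: r_def s_def power2_eq_square field_simps flip: exp_add)
  finally have r: "exp (s * c) * e \<le> r" .
  have e0: "0 \<le> e" unfolding e_def h_def by (intro integral_nonneg_AE) auto
  have "prob {\<omega> \<in> space M. S n \<omega> \<le> c * n} \<le> r ^ n" for n
  proof -
    have X0: "AE \<omega> in M. \<forall>i\<in>{1..n}. 0 \<le> X i \<omega>"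
      by (rule AE_finite_allI) (auto intro: X_nonneg)
    let ?A = "{\<omega> \<in> space M. S n \<omega> \<le> c * n \<and> (\<forall>i\<in>{1..n}. 0 \<le> X i \<omega>)}"
    have meas: "?A \<in> events"
      using X_meas by (intro sets.sets_Collect_conj sets.sets_Collect_finite_All) (auto, measurable)
    have "prob {\<omega> \<in> space M. S n \<omega> \<le> c * n} \<le> prob ?A"
      using X0 meas by (intro finite_measure_mono_AE) auto
    also have "\<dots> \<le> exp (s * c * n) * e ^ n"
      unfolding e_def
    proof (intro chernoff h_int meas)
      fix \<omega> assume \<omega>: "\<omega> \<in> ?A"
      have "(\<Prod>i=1..n. h (X i \<omega>)) = exp (\<Sum>i=1..n. - s * X i \<omega>)"
        using \<omega> by (subst exp_sum) (auto simp: h_def intro!: prod.cong)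
      also have "\<dots> = exp (- s * S n \<omega>)" by (simp add: random_walk_def sum_distrib_left)
      finally have "exp (s * c * n) * (\<Prod>i=1..n. h (X i \<omega>)) = exp (s * (c * n - S n \<omega>))"
        by (simp add: algebra_simps flip: exp_add)
      then show "1 \<le> exp (s * c * n) * (\<Prod>i=1..n. h (X i \<omega>))" using \<omega> s by simp
    qed (auto simp: h_def)
    also have "exp (s * c * n) * e ^ n = (exp (s * c) * e) ^ n"
      by (simp add: power_mult_distrib mult.commute flip: exp_of_nat_mult)
    also have "\<dots> \<le> r ^ n" using r e0 by (intro power_mono) auto
    finally show ?thesis .
  qed
  moreover have "0 < r" "r < 1" using s c by (auto simp: r_def)
  ultimately show ?thesis using that by blast
qed

section \<open>Logarithmic asymptotics of the tails\<close>

definition q :: "real \<Rightarrow> nat \<Rightarrow> real" where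
  "q t n = prob {\<omega> \<in> space M. t < S n \<omega>}"

lemma q_nonneg: "0 \<le> q t n" and q_le_1: "q t n \<le> 1"
  by (auto simp: q_def)

lemma q_Suc: "q t n \<le> q t (Suc n)"
proof -
  have "AE \<omega> in M. 0 \<le> X (Suc n) \<omega>" by (intro X_nonneg) simp
  then have "AE \<omega> in M. S n \<omega> \<le> S (Suc n) \<omega>" by eventually_elim (simp add: random_walk_def)
  then show ?thesis
    unfolding q_def by (intro finite_measure_mono_AE) auto
qed

lemma q_mono: "m \<le> n \<Longrightarrow> q t m \<le> q t n"
  by (rule lift_Suc_mono_le[of "q t"]) (rule q_Suc)

lemma q_pos: "1 \<le> n \<Longrightarrow> 0 < q t n"
proof -
  assume "1 \<le> n"
  have "0 < exp (- H t)" by simp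
  also have "exp (- H t) = q t 1" using X_tail[of 1 t] by (simp add: q_def random_walk_def)
  also have "\<dots> \<le> q t n" by (rule q_mono) fact
  finally show ?thesis .
qed

lemma prob_le_walk: "prob {\<omega> \<in> space M. S n \<omega> \<le> t} = 1 - q t n"
proof -
  have "{\<omega> \<in> space M. S n \<omega> \<le> t} = space M - {\<omega> \<in> space M. t < S n \<omega>}" by auto
  then show ?thesis by (simp add: q_def prob_compl)
qed

lemma one_minus_q_le:
  fixes c t :: real
  assumes r: "\<And>n. prob {\<omega> \<in> space M. S n \<omega> \<le> c * n} \<le> r ^ n" and "t \<le> c * n"
  shows "1 - q t n \<le> r ^ n"
proof -
  have "1 - q t n \<le> prob {\<omega> \<in> space M. S n \<omega> \<le> c * n}"
    using assms unfolding prob_le_walk[symmetric] by (intro finite_measure_mono) auto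
  then show ?thesis using r[of n] by linarith
qed

section \<open>Upper bound on the tails of the walk by truncation\<close>

text \<open>On \<open>0 \<le> y \<le> x\<close> the exponent \<open>l * y\<close> is at most
  \<open>1 + \<theta> * H y\<close> with \<open>\<theta> < 1\<close>, so \<open>exp_moment\<close>
  bounds the second-order remainder of the exponential uniformly in \<open>x\<close>.\<close>

lemma truncated_exp_moment:
  assumes \<delta>: "0 < \<delta>" "\<delta> < 1"
  obtains K where "0 \<le> K" "\<forall>\<^sub>F x in at_top. \<forall>l. l = (1 - \<delta>) * H x / x \<longrightarrow>
    expectation (\<lambda>\<omega>. exp (l * \<xi> \<omega>) * indicator {..x} (\<xi> \<omega>)) \<le> exp (l * \<mu> + l\<^sup>2 * K)"
proof -
  \<comment> \<open>Strictly between \<open>1 - \<delta>\<close> and \<open>1\<close>; the quotient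
    \<open>c\<close> below is the slack available in the Potter bound.\<close>
  define \<theta> where "\<theta> = 1 - \<delta> / 2"
  have \<theta>: "0 \<le> \<theta>" "\<theta> < 1" using \<delta> by (auto simp: \<theta>_def)
  define J where "J = expectation (\<lambda>\<omega>. (\<xi> \<omega>)\<^sup>2 * exp (\<theta> * H (\<xi> \<omega>)))"
  have J: "0 \<le> J" unfolding J_def by (intro integral_nonneg_AE) auto
  define c where "c = \<theta> / (1 - \<delta>)"
  have c: "1 < c" using \<delta> by (simp add: c_def \<theta>_def field_simps)
  \<comment> \<open>Exponent \<open>1\<close> in the Potter bound: \<open>H v / v\<close> is
    decreasing up to the factor \<open>c\<close>.\<close>
  from eventually_conj[OF H_le_power[OF c rho(2)] eventually_gt_at_top[of 0]]
  obtain u where N: "\<forall>v\<ge>u. (\<forall>x\<ge>v. H x \<le> c powr 1 * (x / v) powr 1 * H v) \<and> 0 < v"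
    unfolding eventually_at_top_linorder by blast
  then have u: "0 < u" and le: "\<And>v x. u \<le> v \<Longrightarrow> v \<le> x \<Longrightarrow> H x \<le> c powr 1 * (x / v) powr 1 * H v"
    by blast+
  have "\<forall>\<^sub>F x in at_top. H x / x < 1 / u"
    using H_over_id u by (intro order_tendstoD(2)) auto
  then have "\<forall>\<^sub>F x in at_top. \<forall>l. l = (1 - \<delta>) * H x / x \<longrightarrow>
    expectation (\<lambda>\<omega>. exp (l * \<xi> \<omega>) * indicator {..x} (\<xi> \<omega>)) \<le> exp (l * \<mu> + l\<^sup>2 * (exp 1 * J))"
    using eventually_gt_at_top[of 0]
  proof (eventually_elim, intro allI impI)
    fix x l :: real
    assume x: "H x / x < 1 / u" "0 < x" and l: "l = (1 - \<delta>) * H x / x"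
    have l0: "0 \<le> l" using l x \<delta> H_nonneg[of x] by simp
    have exponent: "l * y \<le> 1 + \<theta> * H y" if y: "0 \<le> y" "y \<le> x" for y
    proof (cases "u \<le> y")
      case True
      have "H x \<le> c * (x / y) * H y" using le[OF True y(2)] c x u True by simp
      then have "(1 - \<delta>) * H x * y \<le> (1 - \<delta>) * (c * (x / y) * H y) * y"
        using \<delta> y by (intro mult_right_mono mult_left_mono) auto
      also have "\<dots> = \<theta> * H y * x" using u True \<delta> by (simp add: c_def)
      finally have "l * y \<le> \<theta> * H y" using x by (simp add: l field_simps)
      then show ?thesis by simp
    next
      case False
      have "l \<le> 1 * (H x / x)"
        unfolding l times_divide_eq_right[symmetric] using \<delta> x H_nonneg[of x] by (intro mult_right_mono) auto
      also have "\<dots> \<le> 1 / u" using x by simp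
      finally have "l * y \<le> 1 / u * u" using False y u l0 by (intro mult_mono) auto
      then show ?thesis using u \<theta> H_nonneg[of y] by (simp add: add_increasing2)
    qed
    \<comment> \<open>The remainder keeps its exponential, in the form that
      \<open>exp_moment\<close> can integrate.\<close>
    have exp_le: "exp z \<le> 1 + z + z\<^sup>2 * exp z" if z: "0 \<le> z" for z :: real
    proof -
      have "(1 - z\<^sup>2) * exp z \<le> 1 + z"
      proof (cases "z < 1")
        case True
        have "(1 - z) * exp z \<le> exp (- z) * exp z"
          using exp_ge_add_one_self[of "- z"] by (intro mult_right_mono) auto
        then have "(1 - z) * exp z \<le> 1" by (simp flip: exp_add)
        then have "(1 + z) * ((1 - z) * exp z) \<le> (1 + z) * 1" using z by (intro mult_left_mono) auto
        then show ?thesis by (simp add: power2_eq_square algebra_simps)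
      next
        case False
        then have "1 - z\<^sup>2 \<le> 0" using power_mono[of 1 z 2] by simp
        then have "(1 - z\<^sup>2) * exp z \<le> 0" by (simp add: mult_nonpos_nonneg)
        then show ?thesis using z by linarith
      qed
      then show ?thesis by (simp add: algebra_simps)
    qed
    have "expectation (\<lambda>\<omega>. exp (l * \<xi> \<omega>) * indicator {..x} (\<xi> \<omega>)) \<le>
      expectation (\<lambda>\<omega>. 1 + l * \<xi> \<omega> + l\<^sup>2 * exp 1 * ((\<xi> \<omega>)\<^sup>2 * exp (\<theta> * H (\<xi> \<omega>))))"
    proof (rule integral_mono_AE)
      show "integrable M (\<lambda>\<omega>. exp (l * \<xi> \<omega>) * indicator {..x} (\<xi> \<omega>))"
        using l0 by (intro integrable_const_bound[of _ "exp (l * x)"]) (auto simp: indicator_def mult_left_mono)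
      show "integrable M (\<lambda>\<omega>. 1 + l * \<xi> \<omega> + l\<^sup>2 * exp 1 * ((\<xi> \<omega>)\<^sup>2 * exp (\<theta> * H (\<xi> \<omega>))))"
        using xi_integrable exp_moment[OF \<theta>]
        by (intro Bochner_Integration.integrable_add integrable_mult_right integrable_const)
      show "AE \<omega> in M. exp (l * \<xi> \<omega>) * indicator {..x} (\<xi> \<omega>)
          \<le> 1 + l * \<xi> \<omega> + l\<^sup>2 * exp 1 * ((\<xi> \<omega>)\<^sup>2 * exp (\<theta> * H (\<xi> \<omega>)))"
        using xi_nonneg
      proof eventually_elim
        case (elim \<omega>)
        define y where "y = \<xi> \<omega>"
        have y: "0 \<le> y" using elim by (simp add: y_def)
        have "exp (l * y) * indicator {..x} y \<le> 1 + l * y + l\<^sup>2 * exp 1 * (y\<^sup>2 * exp (\<theta> * H y))"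
        proof (cases "y \<le> x")
          case True
          have "exp (l * y) \<le> exp 1 * exp (\<theta> * H y)"
            using exponent[OF y True] by (simp flip: exp_add)
          then have "(l * y)\<^sup>2 * exp (l * y) \<le> (l * y)\<^sup>2 * (exp 1 * exp (\<theta> * H y))"
            by (intro mult_left_mono) auto
          then show ?thesis using exp_le[of "l * y"] l0 y True by (simp add: power_mult_distrib mult_ac)
        next
          case False
          then show ?thesis using l0 y by simp
        qed
        then show ?case by (simp add: y_def)
      qed
    qed
    also have "\<dots> = 1 + (l * \<mu> + l\<^sup>2 * (exp 1 * J))"
      using xi_integrable exp_moment[OF \<theta>] by (simp add: \<mu>_def J_def prob_space)
    also have "\<dots> \<le> exp (l * \<mu> + l\<^sup>2 * (exp 1 * J))"
      by (rule exp_ge_add_one_self)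
    finally show "expectation (\<lambda>\<omega>. exp (l * \<xi> \<omega>) * indicator {..x} (\<xi> \<omega>))
      \<le> exp (l * \<mu> + l\<^sup>2 * (exp 1 * J))" .
  qed
  then show ?thesis using that[of "exp 1 * J"] J by simp
qed

text \<open>Either some increment exceeds \<open>x\<close>, which the union bound handles, or none
  does and the exponential bound applies to the truncated weight.\<close>

lemma q_le_truncation:
  assumes "0 \<le> l"
  shows "q t n \<le> n * exp (- H x)
    + exp (- l * t) * expectation (\<lambda>\<omega>. exp (l * \<xi> \<omega>) * indicator {..x} (\<xi> \<omega>)) ^ n"
proof -
  let ?B = "\<lambda>i. {\<omega> \<in> space M. x < X i \<omega>}"
  let ?A = "{\<omega> \<in> space M. t < S n \<omega> \<and> (\<forall>i\<in>{1..n}. X i \<omega> \<le> x)}"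
  have B: "?B i \<in> events" if "i \<in> {1..n}" for i
    using X_meas[of i] that by simp
  have U: "(\<Union>i\<in>{1..n}. ?B i) \<in> events" by (intro sets.finite_UN B) auto
  have A: "?A \<in> events"
  proof -
    have "?A = {\<omega> \<in> space M. t < S n \<omega>} - (\<Union>i\<in>{1..n}. ?B i)" by (auto simp: not_le)
    then show ?thesis using U by simp
  qed
  have "q t n \<le> prob ((\<Union>i\<in>{1..n}. ?B i) \<union> ?A)"
    unfolding q_def by (rule finite_measure_mono[OF _ sets.Un[OF U A]]) (fastforce simp: not_less)
  also have "\<dots> \<le> prob (\<Union>i\<in>{1..n}. ?B i) + prob ?A"
    by (rule measure_Un_le[OF U A])
  also have "prob (\<Union>i\<in>{1..n}. ?B i) \<le> (\<Sum>i\<in>{1..n}. prob (?B i))"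
    by (rule finite_measure_subadditive_finite) (use B in auto)
  also have "\<dots> = n * exp (- H x)" using X_tail by simp
  also have "prob ?A \<le> exp (- l * t) * expectation (\<lambda>\<omega>. exp (l * \<xi> \<omega>) * indicator {..x} (\<xi> \<omega>)) ^ n"
  proof (rule chernoff[where h = "\<lambda>y. exp (l * y) * indicator {..x} y"])
    show "integrable M (\<lambda>\<omega>. exp (l * \<xi> \<omega>) * indicator {..x} (\<xi> \<omega>))"
      using assms by (intro integrable_const_bound[of _ "exp (l * x)"]) (auto simp: indicator_def mult_left_mono)
    fix \<omega> assume \<omega>: "\<omega> \<in> ?A"
    have "(\<Prod>i=1..n. exp (l * X i \<omega>) * indicator {..x} (X i \<omega>)) = exp (\<Sum>i=1..n. l * X i \<omega>)"
      using \<omega> by (subst exp_sum) (auto intro!: prod.cong)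
    also have "\<dots> = exp (l * S n \<omega>)" by (simp add: random_walk_def sum_distrib_left)
    finally have "exp (- l * t) * (\<Prod>i=1..n. exp (l * X i \<omega>) * indicator {..x} (X i \<omega>))
      = exp (l * (S n \<omega> - t))" by (simp add: algebra_simps flip: exp_add)
    then show "1 \<le> exp (- l * t) * (\<Prod>i=1..n. exp (l * X i \<omega>) * indicator {..x} (X i \<omega>))"
      using \<omega> assms by simp
  qed (use A in auto)
  finally show ?thesis by simp
qed

text \<open>The walk at this index has mean about \<open>a * t\<close>, so for \<open>a < 1\<close>
  a big jump has to supply the remaining \<open>(1 - a) * t\<close>.\<close>

abbreviation idx :: "real \<Rightarrow> real \<Rightarrow> nat" where
  "idx a t \<equiv> nat \<lfloor>a * t / \<mu>\<rfloor>"

lemma idx_bounds: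
  assumes "0 \<le> a" "0 \<le> t"
  shows "real (idx a t) \<le> a * t / \<mu>" "a * t / \<mu> < real (idx a t) + 1"
  using assms mu_pos by (auto intro!: of_nat_floor) 

lemma idx_at_top:
  assumes "0 < a"
  shows "filterlim (idx a) at_top at_top"
  unfolding filterlim_at_top
proof
  fix Z :: nat
  show "\<forall>\<^sub>F t in at_top. Z \<le> idx a t"
    using eventually_ge_at_top[of "real Z * \<mu> / a"]
  proof eventually_elim
    case (elim t)
    then have "real Z \<le> a * t / \<mu>" using assms mu_pos by (simp add: field_simps)
    then show ?case by (rule le_nat_floor)
  qed
qed

text \<open>Truncate at \<open>x = (1 - a) * t\<close> with
  \<open>l = (1 - \<delta>) * H x / x\<close>. The linear part of the exponent is at most
  \<open>- l * x = - (1 - \<delta>) * H x\<close>, the quadratic part is \<open>o(H x)\<close>, and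
  the polynomial prefactor costs \<open>2 * ln t = o(H t)\<close>.\<close>

lemma cost_lower:
  assumes a: "0 < a" "a < 1" and y: "y < (1 - a) powr \<rho>"
  shows "\<forall>\<^sub>F t in at_top. y * H t < - ln (q t (idx a t))"
proof -
  have p: "0 < (1 - a) powr \<rho>" using a by simp
  define y' where "y' = max y 0"
  have y': "0 \<le> y'" "y' < (1 - a) powr \<rho>" using y p by (auto simp: y'_def)
  \<comment> \<open>Makes \<open>(1 - \<delta>) * (1 - a) powr \<rho>\<close> the midpoint of
    \<open>y'\<close> and \<open>(1 - a) powr \<rho>\<close>.\<close>
  define \<delta> where "\<delta> = (1 - y' / (1 - a) powr \<rho>) / 2"
  have \<delta>: "0 < \<delta>" "\<delta> < 1" using y' p by (auto simp: \<delta>_def field_simps)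
  have y_less: "y < (1 - \<delta>) * (1 - a) powr \<rho>"
  proof -
    have "(1 - \<delta>) * (1 - a) powr \<rho> = ((1 - a) powr \<rho> + y') / 2"
      using p by (simp add: \<delta>_def field_simps)
    then show ?thesis using y' by (auto simp: y'_def)
  qed
  obtain K where K: "0 \<le> K" and ev: "\<forall>\<^sub>F x in at_top. \<forall>l. l = (1 - \<delta>) * H x / x \<longrightarrow>
    expectation (\<lambda>\<omega>. exp (l * \<xi> \<omega>) * indicator {..x} (\<xi> \<omega>)) \<le> exp (l * \<mu> + l\<^sup>2 * K)"
    by (rule truncated_exp_moment[OF \<delta>])
  \<comment> \<open>From \<open>n \<le> a * t / \<mu>\<close> and \<open>t = x / (1 - a)\<close>:
    the quadratic error \<open>n * l\<^sup>2 * K\<close> is at most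
    \<open>C * (H x / x) * H x\<close>.\<close>
  define C where "C = a / (\<mu> * (1 - a)) * K"
  have scale: "filterlim (\<lambda>t. (1 - a) * t) at_top at_top"
    using a by (intro filterlim_tendsto_pos_mult_at_top[OF tendsto_const _ filterlim_ident]) auto
  have "((\<lambda>t. H ((1 - a) * t) / H t * ((1 - \<delta>) - C * (H ((1 - a) * t) / ((1 - a) * t))) - 2 * (ln t / H t))
    \<longlongrightarrow> (1 - a) powr \<rho> * ((1 - \<delta>) - C * 0) - 2 * 0) at_top"
    using a by (intro tendsto_intros H_ratio ln_over_H filterlim_compose[OF H_over_id scale]) auto
  then have "\<forall>\<^sub>F t in at_top. y < H ((1 - a) * t) / H t * ((1 - \<delta>) - C * (H ((1 - a) * t) / ((1 - a) * t))) - 2 * (ln t / H t)"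
    using y_less by (intro order_tendstoD(1)) (auto simp: mult.commute)
  moreover have "\<forall>\<^sub>F t in at_top. 1 \<le> idx a t"
    using idx_at_top[OF a(1)] by (auto simp: filterlim_at_top)
  moreover have "\<forall>\<^sub>F t in at_top. \<forall>l. l = (1 - \<delta>) * H ((1 - a) * t) / ((1 - a) * t) \<longrightarrow>
    expectation (\<lambda>\<omega>. exp (l * \<xi> \<omega>) * indicator {..(1 - a) * t} (\<xi> \<omega>)) \<le> exp (l * \<mu> + l\<^sup>2 * K)"
    using ev scale by (auto simp: filterlim_iff)
  ultimately show ?thesis
    using H_pos eventually_ge_at_top[of "1 + a / \<mu>"]
  proof eventually_elim
    case (elim t)
    define x where "x = (1 - a) * t"
    define n where "n = idx a t"
    define l where "l = (1 - \<delta>) * H x / x"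
    define D where "D = C * (H x / x)"
    have "0 \<le> a / \<mu>" using a mu_pos by simp
    then have t: "1 \<le> t" using elim by linarith
    then have x: "0 < x" using a by (simp add: x_def)
    have l0: "0 \<le> l" using \<delta> x H_nonneg[of x] by (simp add: l_def)
    have n: "real n * \<mu> \<le> a * t"
      using idx_bounds(1)[of a t] a t unfolding n_def pos_le_divide_eq[OF mu_pos] by simp
    have lx: "l * x = (1 - \<delta>) * H x" using x by (simp add: l_def)
    have nl: "real n * (l\<^sup>2 * K) \<le> D * H x"
    proof -
      have "l \<le> H x / x" using \<delta> x H_nonneg[of x] by (simp add: l_def field_simps)
      then have "l\<^sup>2 \<le> (H x / x)\<^sup>2" using l0 by (intro power_mono)
      then have "real n * (l\<^sup>2 * K) \<le> a * t / \<mu> * ((H x / x)\<^sup>2 * K)"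
        using n K a t mu_pos by (intro mult_mono) (auto simp: field_simps)
      also have "\<dots> = D * H x"
      proof -
        have "t = x / (1 - a)" using a by (simp add: x_def)
        then show ?thesis by (simp add: D_def C_def power2_eq_square mult_ac)
      qed
      finally show ?thesis .
    qed
    have "expectation (\<lambda>\<omega>. exp (l * \<xi> \<omega>) * indicator {..x} (\<xi> \<omega>)) \<le> exp (l * \<mu> + l\<^sup>2 * K)"
      using elim(3) by (simp add: l_def x_def)
    then have "expectation (\<lambda>\<omega>. exp (l * \<xi> \<omega>) * indicator {..x} (\<xi> \<omega>)) ^ n \<le> exp (l * \<mu> + l\<^sup>2 * K) ^ n"
      by (intro power_mono integral_nonneg_AE) auto
    then have "q t n \<le> n * exp (- H x) + exp (- l * t) * exp (l * \<mu> + l\<^sup>2 * K) ^ n"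
      by (intro order_trans[OF q_le_truncation[OF l0, of t n x]] add_left_mono mult_left_mono) auto
    also have "exp (- l * t) * exp (l * \<mu> + l\<^sup>2 * K) ^ n = exp (l * (real n * \<mu> - t) + real n * (l\<^sup>2 * K))"
      by (simp add: algebra_simps flip: exp_add exp_of_nat_mult)
    also have "\<dots> \<le> exp (- ((1 - \<delta>) * H x) + D * H x)"
    proof -
      have "l * (real n * \<mu> - t) \<le> l * (- x)"
        using n l0 by (intro mult_left_mono) (auto simp: x_def algebra_simps)
      then show ?thesis using lx nl by simp
    qed
    also have "n * exp (- H x) \<le> n * exp (- ((1 - \<delta>) * H x) + D * H x)"
    proof -
      have "0 \<le> D" using K a mu_pos x H_nonneg[of x] by (auto simp: D_def C_def)
      then have "0 \<le> \<delta> * H x" "0 \<le> D * H x" using \<delta> H_nonneg[of x] by auto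
      then show ?thesis by (intro mult_left_mono) (auto simp: algebra_simps)
    qed
    finally have "q t n \<le> (n + 1) * exp (- ((1 - \<delta>) * H x) + D * H x)" by (simp add: algebra_simps)
    also have "real (n + 1) \<le> t\<^sup>2"
    proof -
      have "real n \<le> a / \<mu> * t" using n mu_pos by (simp add: field_simps)
      then have "real (n + 1) \<le> a / \<mu> * t + 1 * t" using t by simp
      also have "\<dots> = (1 + a / \<mu>) * t" by (simp add: algebra_simps)
      also have "\<dots> \<le> t * t" using elim t by (intro mult_right_mono) auto
      finally show ?thesis by (simp add: power2_eq_square)
    qed
    finally have "q t n \<le> t\<^sup>2 * exp (- ((1 - \<delta>) * H x) + D * H x)" by simp
    moreover have "0 < q t n" using elim(2) q_pos by (simp add: n_def)
    ultimately have "ln (q t n) \<le> ln (t\<^sup>2 * exp (- ((1 - \<delta>) * H x) + D * H x))"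
      using t by (subst ln_le_cancel_iff) auto
    also have "\<dots> = 2 * ln t - ((1 - \<delta>) * H x) + D * H x"
      using t by (simp add: ln_mult ln_realpow)
    finally have "H x * ((1 - \<delta>) - D) - 2 * ln t \<le> - ln (q t n)" by (simp add: algebra_simps)
    moreover have "y * H t < H x * ((1 - \<delta>) - D) - 2 * ln t"
    proof -
      have "y < (H x * ((1 - \<delta>) - D) - 2 * ln t) / H t"
        using elim(1) unfolding x_def[symmetric] D_def[symmetric] by (simp add: diff_divide_distrib)
      then show ?thesis using elim(4) by (simp only: pos_less_divide_eq)
    qed
    ultimately show ?case by (simp add: n_def)
  qed
qed

section \<open>Lower bound on the tails of the walk by one big jump\<close>

text \<open>The last summand exceeds \<open>x\<close> and, independently, the first \<open>m\<close>
  together exceed \<open>z\<close>.\<close>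

lemma q_ge_jump: "exp (- H x) * q z m \<le> q (x + z) (Suc m)"
proof -
  have "indep_var borel (X (Suc m)) borel (\<lambda>\<omega>. \<Sum>i\<in>{1..m}. X i \<omega>)"
    by (rule indep_vars_sum) (auto intro: indep_vars_subset[OF X_indep])
  then have ind: "indep_var borel (X (Suc m)) borel (S m)"
    by (simp add: random_walk_def[abs_def])
  have "exp (- H x) * q z m = prob (X (Suc m) -` {x<..} \<inter> space M) * prob (S m -` {z<..} \<inter> space M)"
    using X_tail[of "Suc m" x] unfolding q_def
    by (simp add: vimage_def Int_def conj_commute)
  also have "\<dots> = prob ((\<lambda>\<omega>. (X (Suc m) \<omega>, S m \<omega>)) -` ({x<..} \<times> {z<..}) \<inter> space M)"
    by (rule indep_varD[OF ind, symmetric]) auto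
  also have "\<dots> \<le> q (x + z) (Suc m)"
    unfolding q_def by (rule finite_measure_mono) (force simp: random_walk_def, measurable)
  finally show ?thesis .
qed

text \<open>One jump over \<open>(1 - a + \<eta>) * t\<close> suffices, since the other summands
  reach nearly their mean with probability at least \<open>1 / 2\<close>. Continuity of the power
  lets \<open>\<eta>\<close> be small.\<close>

lemma cost_upper:
  assumes a: "0 < a" "a < 1" and y: "(1 - a) powr \<rho> < y"
  shows "\<forall>\<^sub>F t in at_top. - ln (q t (idx a t)) < y * H t"
proof -
  have "((\<lambda>\<eta>. (1 - a + \<eta>) powr \<rho>) \<longlongrightarrow> (1 - a + 0) powr \<rho>) (at_right 0)"
    using a by (intro tendsto_intros) auto
  then have "\<forall>\<^sub>F \<eta> in at_right 0. (1 - a + \<eta>) powr \<rho> < y"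
    using y by (intro order_tendstoD(2)) auto
  with eventually_at_right_real[OF zero_less_one]
  have "\<forall>\<^sub>F \<eta> in at_right 0. (1 - a + \<eta>) powr \<rho> < y \<and> 0 < \<eta> \<and> \<eta> < 1"
    by eventually_elim auto
  from eventually_happens'[OF _ this] obtain \<eta>
    where \<eta>: "(1 - a + \<eta>) powr \<rho> < y" "0 < \<eta>" "\<eta> < 1" by auto
  \<comment> \<open>Then \<open>c * m\<close> misses \<open>a * t\<close> by at most
    \<open>\<eta> / 2 * t + 2 * c\<close>, and \<open>t \<ge> 4 * \<mu> / \<eta>\<close> bounds this
    by \<open>\<eta> * t\<close>.\<close>
  define c where "c = \<mu> * (1 - \<eta> / 2)"
  have c: "0 < c" "c < \<mu>" using \<eta> mu_pos by (auto simp: c_def)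
  obtain r where r: "0 < r" "r < 1" "\<And>n. prob {\<omega> \<in> space M. S n \<omega> \<le> c * n} \<le> r ^ n"
    using lower_tail[OF c(2)] by blast
  have "\<forall>\<^sub>F n in sequentially. r ^ n < 1 / 2"
    using r by (intro order_tendstoD(2)[OF LIMSEQ_realpow_zero]) auto
  then have "\<forall>\<^sub>F t in at_top. r ^ (idx a t - 1) < 1 / 2"
    using filterlim_compose[OF filterlim_minus_const_nat_at_top idx_at_top[OF a(1)], of 1]
    by (auto simp: filterlim_iff)
  moreover have "((\<lambda>t. H ((1 - a + \<eta>) * t) / H t + ln 2 / H t) \<longlongrightarrow> (1 - a + \<eta>) powr \<rho> + 0) at_top"
    using a \<eta> by (intro tendsto_intros H_ratio tendsto_divide_0[OF tendsto_const] filterlim_at_top_imp_at_infinity H_at_top) auto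
  then have "\<forall>\<^sub>F t in at_top. H ((1 - a + \<eta>) * t) / H t + ln 2 / H t < y"
    using \<eta> by (intro order_tendstoD(2)) auto
  moreover have "\<forall>\<^sub>F t in at_top. 1 \<le> idx a t"
    using idx_at_top[OF a(1)] by (auto simp: filterlim_at_top)
  ultimately show ?thesis
    using H_pos eventually_ge_at_top[of "4 * \<mu> / \<eta>"] eventually_ge_at_top[of 0]
  proof eventually_elim
    case (elim t)
    define m where "m = idx a t - 1"
    define x where "x = (1 - a + \<eta>) * t"
    have Suc_m: "idx a t = Suc m" using elim(3) by (simp add: m_def)
    \<comment> \<open>One unit is lost to the floor and one to the summand reserved for the
      jump.\<close>
    have "a * t / \<mu> - 2 \<le> real m"
      using idx_bounds(2)[of a t] a elim(6) unfolding Suc_m by simp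
    then have "c * (a * t / \<mu> - 2) \<le> c * m" using c by (intro mult_left_mono) auto
    moreover have "c * (a * t / \<mu> - 2) = a * t - \<eta> / 2 * (a * t) - 2 * c"
      using mu_pos by (simp add: c_def field_simps)
    moreover have "\<eta> / 2 * (a * t) \<le> \<eta> / 2 * t"
      using a elim(6) \<eta> by (intro mult_left_mono) (auto intro: mult_left_le_one_le)
    moreover have "2 * c \<le> \<eta> / 2 * t" using c elim(5) \<eta> by (simp add: field_simps)
    ultimately have "t \<le> x + c * m" by (simp add: x_def algebra_simps)
    have "exp (- H x) * (1 / 2) \<le> exp (- H x) * q (c * m) m"
      using one_minus_q_le[OF r(3), of "c * m" m] elim(1) by (intro mult_left_mono) (auto simp: m_def)
    also have "\<dots> \<le> q (x + c * m) (Suc m)" by (rule q_ge_jump)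
    also have "\<dots> \<le> q t (Suc m)"
      unfolding q_def using \<open>t \<le> x + c * m\<close> by (intro finite_measure_mono) auto
    finally have "ln (exp (- H x) * (1 / 2)) \<le> ln (q t (Suc m))" by (subst ln_le_cancel_iff) (auto simp: q_pos)
    then have "- ln (q t (Suc m)) \<le> H x + ln 2" by (simp add: ln_mult ln_div)
    also have "\<dots> < y * H t" using elim(2) elim(4) by (simp add: x_def field_simps)
    finally show ?case by (simp add: Suc_m)
  qed
qed

text \<open>The mean of the walk is now past \<open>t\<close>, so \<open>q\<close> is eventually at
  least \<open>1 / 2\<close> and its cost stays bounded while \<open>H\<close> diverges.\<close>

lemma cost_beyond:
  assumes a: "1 < a"
  shows "((\<lambda>t. - ln (q t (idx a t)) / H t) \<longlongrightarrow> 0) at_top"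
proof -
  \<comment> \<open>The midpoint of \<open>\<mu> / a\<close> and \<open>\<mu>\<close>: below the
    mean, yet \<open>c * (a * t / \<mu>)\<close> exceeds \<open>t\<close> by
    \<open>(a - 1) / 2 * t\<close>.\<close>
  define c where "c = \<mu> * ((1 + 1 / a) / 2)"
  have c: "0 < c" "c < \<mu>" using a mu_pos by (auto simp: c_def intro!: mult_pos_pos add_pos_pos)
  obtain r where r: "0 < r" "r < 1" "\<And>n. prob {\<omega> \<in> space M. S n \<omega> \<le> c * n} \<le> r ^ n"
    using lower_tail[OF c(2)] by blast
  have a0: "0 < a" using a by simp
  have "\<forall>\<^sub>F n in sequentially. r ^ n < 1 / 2"
    using r by (intro order_tendstoD(2)[OF LIMSEQ_realpow_zero]) auto
  then have "\<forall>\<^sub>F t in at_top. r ^ (idx a t) < 1 / 2"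
    using idx_at_top[OF a0] by (auto simp: filterlim_iff)
  then have "\<forall>\<^sub>F t in at_top. - ln (q t (idx a t)) / H t \<le> ln 2 / H t"
    using H_pos eventually_ge_at_top[of "2 * c / (a - 1)"] eventually_ge_at_top[of 0]
  proof eventually_elim
    case (elim t)
    have "c * (a * t / \<mu> - 1) \<le> c * idx a t"
      using idx_bounds(2)[of a t] a elim(4) c by (intro mult_left_mono) auto
    moreover have "c * (a * t / \<mu> - 1) = t + (a - 1) / 2 * t - c"
      using mu_pos a by (simp add: c_def field_simps)
    moreover have "c \<le> (a - 1) / 2 * t" using elim(3) a by (simp add: field_simps)
    ultimately have "t \<le> c * idx a t" by linarith
    from one_minus_q_le[OF r(3) this] have "1 / 2 \<le> q t (idx a t)" using elim(1) by linarith
    then have "ln (1 / 2) \<le> ln (q t (idx a t))" by (subst ln_le_cancel_iff) auto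
    then have "- ln (q t (idx a t)) \<le> ln 2" by (simp add: ln_div)
    then show ?case using elim(2) by (intro divide_right_mono) auto
  qed
  moreover have "\<forall>\<^sub>F t in at_top. 0 \<le> - ln (q t (idx a t)) / H t"
  proof (rule always_eventually, rule allI)
    fix t
    have "ln (q t (idx a t)) \<le> 0"
      using q_le_1[of t "idx a t"] q_nonneg[of t "idx a t"] by (cases "q t (idx a t) = 0") auto
    then show "0 \<le> - ln (q t (idx a t)) / H t" using H_nonneg[of t] by (intro divide_nonneg_nonneg) auto
  qed
  moreover have "((\<lambda>t. ln 2 / H t) \<longlongrightarrow> 0) at_top"
    by (intro tendsto_divide_0[OF tendsto_const] filterlim_at_top_imp_at_infinity H_at_top)
  ultimately show ?thesis by - (rule tendsto_sandwich[OF _ _ tendsto_const])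
qed

text \<open>\<open>max 0\<close> and \<open>0 powr \<rho> = 0\<close> unite both regimes. Leaving
  out \<open>a = 1\<close> does no harm, as the limit is only integrated over
  \<open>a\<close>.\<close>

lemma cost_tendsto:
  assumes a: "0 < a" "a \<noteq> 1"
  shows "((\<lambda>t. - ln (q t (idx a t)) / H t) \<longlongrightarrow> max 0 (1 - a) powr \<rho>) at_top"
proof (cases "a < 1")
  case True
  then have m: "max 0 (1 - a) powr \<rho> = (1 - a) powr \<rho>" by simp
  show ?thesis unfolding m
  proof (rule order_tendstoI)
    fix y assume "y < (1 - a) powr \<rho>"
    from cost_lower[OF a(1) True this] H_pos
    show "\<forall>\<^sub>F t in at_top. y < - ln (q t (idx a t)) / H t"
      by eventually_elim (simp only: pos_less_divide_eq)
  next
    fix y assume "(1 - a) powr \<rho> < y"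
    from cost_upper[OF a(1) True this] H_pos
    show "\<forall>\<^sub>F t in at_top. - ln (q t (idx a t)) / H t < y"
      by eventually_elim (simp only: pos_divide_less_eq)
  qed
next
  case False
  then show ?thesis using cost_beyond[of a] a by simp
qed

end

section \<open>From the pointwise limit to the sum of the costs\<close>

lemma LBINT_powr_reflected:
  fixes b r :: real
  assumes "b \<le> 1" "0 < r"
  shows "(LINT a|lborel. indicator {b..1} a * (1 - a) powr r) = (1 - b) powr (r + 1) / (r + 1)"
proof -
  have "(LINT a|lborel. indicator {b..1} a * (1 - a) powr r)
      = (LINT u|lborel. indicator {b..1} (1 + (- 1) * u) * (1 - (1 + (- 1) * u)) powr r)"
    by (subst lborel_integral_real_affine[where c = "- 1" and t = 1]) auto
  also have "\<dots> = (LINT u:{0..1 - b}|lborel. u powr r)"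
    unfolding set_lebesgue_integral_def
    by (intro Bochner_Integration.integral_cong) (auto simp: indicator_def)
  also have "\<dots> = integral {0..1 - b} (\<lambda>u. u powr r)"
    using assms by (intro set_borel_integral_eq_integral(2) borel_integrable_atLeastAtMost' continuous_on_powr'
      continuous_on_id continuous_on_const) auto
  also have "\<dots> = (1 - b) powr (r + 1) / (r + 1)"
    using has_integral_powr_from_0[of r "1 - b"] assms by (intro integral_unique) auto
  finally show ?thesis .
qed

context heavy_walk
begin

text \<open>\<open>1 \<le> m\<close> matters: for \<open>t \<ge> 0\<close> the empty sum has
  \<open>q t 0 = 0\<close>, and \<open>ln 0 = 0\<close> can break the monotonicity.\<close>

lemma cost_antimono:
  assumes "1 \<le> m" "m \<le> n"
  shows "- ln (q t n) \<le> - ln (q t m)"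
  using q_pos[OF assms(1), of t] q_mono[OF assms(2), of t] by simp

lemma cost_nonneg: "0 \<le> - ln (q t n)"
  using q_le_1[of t n] q_nonneg[of t n] by (cases "q t n = 0") auto

text \<open>These level sets turn the sum into an integral. For \<open>n = 0\<close> the level set
  is a half line, because \<open>nat\<close> sends negative floors to \<open>0\<close>.\<close>

lemma idx_eq_iff:
  assumes "1 \<le> n" "0 < t"
  shows "idx a t = n \<longleftrightarrow> a \<in> {real n * \<mu> / t ..< (real n + 1) * \<mu> / t}"
proof -
  have "idx a t = n \<longleftrightarrow> \<lfloor>a * t / \<mu>\<rfloor> = int n" using assms(1) by linarith
  also have "\<dots> \<longleftrightarrow> real n \<le> a * t / \<mu> \<and> a * t / \<mu> < real n + 1" by (simp add: floor_eq_iff)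
  also have "\<dots> \<longleftrightarrow> a \<in> {real n * \<mu> / t ..< (real n + 1) * \<mu> / t}"
    using assms(2) mu_pos by (simp add: field_simps)
  finally show ?thesis .
qed

lemma idx_mono: "0 \<le> t \<Longrightarrow> a \<le> a' \<Longrightarrow> idx a t \<le> idx a' t"
  using mu_pos by (intro nat_mono floor_mono divide_right_mono mult_right_mono) auto

lemma idx_less:
  assumes "0 \<le> a" "a < a'"
  shows "\<forall>\<^sub>F t in at_top. idx a t < idx a' t"
  using eventually_ge_at_top[of "\<mu> / (a' - a)"] eventually_ge_at_top[of 0]
proof eventually_elim
  case (elim t)
  have "1 \<le> (a' - a) * t / \<mu>" using elim assms mu_pos by (simp add: field_simps)
  then have "a * t / \<mu> + 1 \<le> a' * t / \<mu>" by (simp add: left_diff_distrib diff_divide_distrib)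
  moreover have "0 \<le> a * t / \<mu>" using assms elim mu_pos by simp
  ultimately show ?case by linarith
qed

text \<open>The cutoff \<open>2\<close> is one choice of a constant above \<open>1\<close>: between
  \<open>1\<close> and \<open>2\<close> the costs are \<open>o(H t)\<close>, and beyond it the
  deviations \<open>1 - q t n\<close> decay geometrically.\<close>

definition cost_sum :: "real \<Rightarrow> real \<Rightarrow> real" where
  "cost_sum b t = (\<Sum>n\<in>{idx b t<..idx 2 t}. - ln (q t n))"

text \<open>The normalised sum is the integral of the step function \<open>a \<mapsto> - ln (q t (idx a t)) / H t\<close>,
  so that \<open>cost_tendsto\<close> and dominated convergence give its limit.\<close>

lemma cost_sum_tendsto:
  assumes b: "0 < b" "b < 1"
  shows "((\<lambda>t. cost_sum b t / (t * H t)) \<longlongrightarrow> (1 - b) powr (\<rho> + 1) / (\<mu> * (\<rho> + 1))) at_top"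
proof -
  \<comment> \<open>A finite sum of indicators is visibly measurable and integrates term by term;
    \<open>s_eq\<close> is its pointwise form.\<close>
  define s where "s t a = (\<Sum>n\<in>{idx b t<..idx 2 t}.
    - ln (q t n) / H t * indicator {real n * \<mu> / t ..< (real n + 1) * \<mu> / t} a)" for t a
  have s_eq: "s t a = (if idx b t < idx a t \<and> idx a t \<le> idx 2 t then - ln (q t (idx a t)) / H t else 0)"
    if t: "0 < t" for t a
  proof -
    have "s t a = (\<Sum>n\<in>{idx b t<..idx 2 t}. if idx a t = n then - ln (q t n) / H t else 0)"
      unfolding s_def
    proof (rule sum.cong[OF refl])
      fix n assume "n \<in> {idx b t<..idx 2 t}"
      then have "1 \<le> n" by simp
      from idx_eq_iff[OF this t, of a]
      show "- ln (q t n) / H t * indicator {real n * \<mu> / t ..< (real n + 1) * \<mu> / t} a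
        = (if idx a t = n then - ln (q t n) / H t else 0)" by (simp add: indicator_def)
    qed
    then show ?thesis by (simp add: sum.delta')
  qed
  define f where "f a = indicator {b..1} a * (1 - a) powr \<rho>" for a
  have lim: "((\<lambda>t. s t a) \<longlongrightarrow> f a) at_top" if a: "a \<notin> {b, 1, 2}" for a
  proof -
    consider "a < b" | "b < a" "a < 2" | "2 < a" using a by fastforce
    then show ?thesis
    proof cases
      case 1
      have "\<forall>\<^sub>F t in at_top. 0 = s t a" using eventually_gt_at_top[of 0]
      proof eventually_elim
        case (elim t)
        then have "\<not> idx b t < idx a t" using 1 idx_mono[of t a b] by linarith
        then show ?case using elim by (simp only: s_eq simp_thms if_False)
      qed
      moreover have "f a = 0" using 1 by (simp add: f_def)
      ultimately show ?thesis by (auto intro: tendsto_eventually elim: eventually_mono)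
    next
      case 2
      have "f a = max 0 (1 - a) powr \<rho>" using 2 by (auto simp: f_def indicator_def max_def)
      moreover have "\<forall>\<^sub>F t in at_top. idx b t < idx a t" using 2 b by (intro idx_less) auto
      then have "\<forall>\<^sub>F t in at_top. - ln (q t (idx a t)) / H t = s t a"
        using eventually_gt_at_top[of 0]
      proof eventually_elim
        case (elim t)
        then have "idx a t \<le> idx 2 t" using 2 by (intro idx_mono) auto
        then show ?case using elim by (simp only: s_eq simp_thms if_True)
      qed
      ultimately show ?thesis using cost_tendsto[of a] 2 b a by (auto elim: Lim_transform_eventually)
    next
      case 3
      have "\<forall>\<^sub>F t in at_top. idx 2 t < idx a t" using 3 by (intro idx_less) auto
      then have "\<forall>\<^sub>F t in at_top. 0 = s t a"
        using eventually_gt_at_top[of 0]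
        by eventually_elim (simp only: s_eq not_le[symmetric] simp_thms if_False)
      moreover have "f a = 0" using 3 by (simp add: f_def)
      ultimately show ?thesis by (auto intro: tendsto_eventually elim: eventually_mono)
    qed
  qed
  \<comment> \<open>Exceeds the limiting cost at \<open>b\<close>, which bounds all later costs by
    monotonicity. The support lies in \<open>{0..3}\<close> since
    \<open>idx a t \<le> idx 2 t\<close> forces \<open>a * t < 2 * t + \<mu> \<le> 3 * t\<close>
    once \<open>t \<ge> \<mu>\<close>.\<close>
  define C where "C = (1 - b) powr \<rho> + 1"
  have "((\<lambda>t. LINT a|lborel. s t a) \<longlongrightarrow> (LINT a|lborel. f a)) at_top"
  proof (rule integral_dominated_convergence_at_top[where w = "\<lambda>a. C * indicator {0..3} a"])
    show "f \<in> borel_measurable lborel" unfolding f_def by measurable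
    show "s t \<in> borel_measurable lborel" for t unfolding s_def by measurable
    show "integrable lborel (\<lambda>a. C * indicator {0..3::real} a)" by simp
    have "AE a in lborel. a \<notin> {b, 1, 2}" by (intro AE_not_in countable_imp_null_set_lborel) auto
    then show "AE a in lborel. ((\<lambda>t. s t a) \<longlongrightarrow> f a) at_top" by eventually_elim (rule lim)
    have "\<forall>\<^sub>F t in at_top. - ln (q t (idx b t)) < C * H t"
      using b by (intro cost_upper) (auto simp: C_def)
    moreover have "\<forall>\<^sub>F t in at_top. 1 \<le> idx b t"
      using idx_at_top[OF b(1)] by (auto simp: filterlim_at_top)
    ultimately show "\<forall>\<^sub>F t in at_top. AE a in lborel. norm (s t a) \<le> C * indicator {0..3} a"
      using H_pos eventually_gt_at_top[of 0] eventually_ge_at_top[of \<mu>]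
    proof eventually_elim
      case (elim t)
      show ?case
      proof (rule AE_I2)
        fix a
        show "norm (s t a) \<le> C * indicator {0..3} a"
        proof (cases "idx b t < idx a t \<and> idx a t \<le> idx 2 t")
          case True
          define z where "z = - ln (q t (idx a t)) / H t"
          have z: "s t a = z" using True elim(4) by (simp only: s_eq z_def simp_thms if_True)
          have "- ln (q t (idx a t)) \<le> - ln (q t (idx b t))"
            using True elim(2) by (intro cost_antimono) auto
          then have "- ln (q t (idx a t)) \<le> C * H t" using elim(1) by linarith
          then have "z \<le> C" using elim(3) by (simp only: z_def pos_divide_le_eq)
          moreover have "0 \<le> z"
            unfolding z_def using elim(3) by (intro divide_nonneg_nonneg cost_nonneg) auto
          moreover have "0 < a"
          proof -
            have "0 < a * t / \<mu>" using True by linarith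
            then show ?thesis using elim(4) mu_pos by (simp add: zero_less_mult_iff zero_less_divide_iff)
          qed
          moreover have "a \<le> 3"
          proof (rule ccontr)
            assume "\<not> a \<le> 3"
            then have "3 * t \<le> a * t" using elim(4) by simp
            then have "2 * t + \<mu> \<le> a * t" using elim(5) by linarith
            then have "(2 * t + \<mu>) / \<mu> \<le> a * t / \<mu>" using mu_pos by (intro divide_right_mono) auto
            then have "2 * t / \<mu> + 1 \<le> a * t / \<mu>" using mu_pos by (simp add: add_divide_distrib)
            moreover have "0 \<le> 2 * t / \<mu>" using elim(4) mu_pos by simp
            ultimately have "idx 2 t < idx a t" by linarith
            then show False using True by linarith
          qed
          ultimately show ?thesis by (simp add: z)
        next
          case False
          then have "s t a = 0" using elim(4) by (simp only: s_eq if_False)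
          then show ?thesis by (simp add: C_def)
        qed
      qed
    qed
  qed
  also have "(LINT a|lborel. f a) = (1 - b) powr (\<rho> + 1) / (\<rho> + 1)"
    unfolding f_def using b rho by (intro LBINT_powr_reflected) auto
  finally have "((\<lambda>t. (LINT a|lborel. s t a) / \<mu>) \<longlongrightarrow> (1 - b) powr (\<rho> + 1) / (\<rho> + 1) / \<mu>) at_top"
    using mu_pos by (intro tendsto_divide) auto
  moreover have "\<forall>\<^sub>F t in at_top. (LINT a|lborel. s t a) / \<mu> = cost_sum b t / (t * H t)"
    using eventually_gt_at_top[of 0]
  proof eventually_elim
    case (elim t)
    have le: "real n * \<mu> / t \<le> (real n + 1) * \<mu> / t" for n :: nat
      using mu_pos elim by (intro divide_right_mono mult_right_mono) auto
    have "(LINT a|lborel. s t a) = (\<Sum>n\<in>{idx b t<..idx 2 t}. - ln (q t n) / H t * (\<mu> / t))"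
      unfolding s_def
    proof (subst Bochner_Integration.integral_sum)
      show "(\<Sum>n\<in>{idx b t<..idx 2 t}. LINT a|lborel. - ln (q t n) / H t *
          indicator {real n * \<mu> / t ..< (real n + 1) * \<mu> / t} a)
        = (\<Sum>n\<in>{idx b t<..idx 2 t}. - ln (q t n) / H t * (\<mu> / t))"
      proof (rule sum.cong[OF refl])
        fix n
        have "(real n + 1) * \<mu> / t - real n * \<mu> / t = \<mu> / t"
          by (simp add: distrib_right add_divide_distrib)
        with le[of n] show "(LINT a|lborel. - ln (q t n) / H t * indicator {real n * \<mu> / t ..< (real n + 1) * \<mu> / t} a)
          = - ln (q t n) / H t * (\<mu> / t)" by simp
      qed
    qed (intro integrable_mult_right integrable_real_indicator, auto simp: le)
    also have "\<dots> = cost_sum b t * (\<mu> / (t * H t))"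
      unfolding cost_sum_def sum_distrib_right by (intro sum.cong) auto
    finally show ?case using mu_pos by simp
  qed
  ultimately have "((\<lambda>t. cost_sum b t / (t * H t)) \<longlongrightarrow> (1 - b) powr (\<rho> + 1) / (\<rho> + 1) / \<mu>) at_top"
    by (rule Lim_transform_eventually)
  then show ?thesis by (simp add: mult.commute)
qed

end

section \<open>The decoupled count\<close>

text \<open>Increasing factors in \<open>[0, 1]\<close> have the largest product on the last
  \<open>m - k\<close> indices. In the induction, a set without the top index is compared with the
  block one lower, which is then shifted up by one.\<close>

lemma prod_le_top_block:
  fixes p :: "nat \<Rightarrow> real"
  assumes p: "\<And>n. 0 \<le> p n" "\<And>n. p n \<le> 1" "\<And>n. p n \<le> p (Suc n)"
    and A: "A \<subseteq> {1..m}" "m \<le> card A + k"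
  shows "(\<Prod>n\<in>A. p n) \<le> (\<Prod>n\<in>{k<..m}. p n)"
  using A
proof (induction m arbitrary: A k)
  case 0
  then show ?case by simp
next
  case (Suc m)
  have fin: "finite A" using Suc.prems(1) by (rule finite_subset) simp
  show ?case
  proof (cases "Suc m \<le> k")
    case True
    then show ?thesis using p by (simp add: prod_le_1)
  next
    case False
    have top: "{k<..Suc m} = insert (Suc m) {k<..m}" using False by auto
    show ?thesis
    proof (cases "Suc m \<in> A")
      case True
      let ?B = "A - {Suc m}"
      have "?B \<subseteq> {1..m}" using Suc.prems(1) by (auto simp: le_Suc_eq)
      moreover have "m \<le> card ?B + k" using Suc.prems(2) True fin by (simp add: card_Diff_singleton)
      ultimately have "(\<Prod>n\<in>?B. p n) \<le> (\<Prod>n\<in>{k<..m}. p n)" by (rule Suc.IH)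
      then have "p (Suc m) * (\<Prod>n\<in>?B. p n) \<le> p (Suc m) * (\<Prod>n\<in>{k<..m}. p n)"
        using p by (intro mult_left_mono)
      then show ?thesis using True fin by (simp add: top prod.remove)
    next
      case notin: False
      have B: "A \<subseteq> {1..m}" using Suc.prems(1) notin by (auto simp: le_Suc_eq)
      have "card A \<le> m" using card_mono[OF _ B] by simp
      then obtain k' where k: "k = Suc k'" using Suc.prems(2) by (cases k) auto
      have "(\<Prod>n\<in>A. p n) \<le> (\<Prod>n\<in>{k'<..m}. p n)"
        using B Suc.prems(2) k by (intro Suc.IH) auto
      also have "\<dots> \<le> (\<Prod>n\<in>{k'<..m}. p (Suc n))" using p by (intro prod_mono) auto
      also have "\<dots> = (\<Prod>n\<in>Suc ` {k'<..m}. p n)" by (simp add: prod.reindex)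
      also have "Suc ` {k'<..m} = {k<..Suc m}" unfolding k 
          by (simp add: image_Suc_atLeastAtMost flip: atLeastSucAtMost_greaterThanAtMost)
      finally show ?thesis .
    qed
  qed
qed

text \<open>The Weierstrass product inequality; it keeps the factors far beyond the mean index away
  from \<open>0\<close>.\<close>

lemma prod_ge_one_minus_sum:
  fixes p :: "nat \<Rightarrow> real"
  assumes "finite A" "\<And>n. 0 \<le> p n" "\<And>n. p n \<le> 1"
  shows "1 - (\<Sum>n\<in>A. 1 - p n) \<le> (\<Prod>n\<in>A. p n)"
  using assms(1)
proof (induction A)
  case (insert x A)
  have "(\<Prod>n\<in>A. p n) \<le> 1" using assms by (intro prod_le_1) auto
  then have "(1 - p x) * (\<Prod>n\<in>A. p n) \<le> (1 - p x) * 1" using assms by (intro mult_left_mono) auto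
  then show ?case using insert by (simp add: algebra_simps)
qed simp

locale decoupled_walk = heavy_walk +
  fixes S' :: "nat \<Rightarrow> 'a \<Rightarrow> real"
  assumes dec: "decoupled M (random_walk X) S'"
begin

lemma S'_indep: "indep_vars (\<lambda>_. borel) S' {1..}"
  using dec by (simp add: decoupled_def)

lemma S'_meas: "1 \<le> n \<Longrightarrow> S' n \<in> borel_measurable M"
  using S'_indep by (auto simp: indep_vars_def)

lemma S'_prob:
  assumes "1 \<le> n" "A \<in> sets borel"
  shows "prob (S' n -` A \<inter> space M) = prob (S n -` A \<inter> space M)"
proof -
  have "distr M borel (S' n) = distr M borel (S n)"
    using dec assms(1) by (simp add: decoupled_def)
  then have "measure (distr M borel (S' n)) A = measure (distr M borel (S n)) A" by simp
  then show ?thesis using S'_meas[OF assms(1)] assms(2) by (simp add: measure_distr)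
qed

lemma S'_gt: "1 \<le> n \<Longrightarrow> prob (S' n -` {t<..} \<inter> space M) = q t n"
  by (simp add: S'_prob) (simp add: q_def vimage_def Int_def conj_commute)

lemma S'_le: "1 \<le> n \<Longrightarrow> prob (S' n -` {..t} \<inter> space M) = 1 - q t n"
  by (simp add: S'_prob) (simp add: prob_le_walk[symmetric] vimage_def Int_def conj_commute)

text \<open>The set-builder form covers \<open>J = {}\<close> too, where the event is the whole
  space and not an empty intersection.\<close>

lemma S'_joint:
  assumes "finite J" "J \<subseteq> {1..}" "\<And>n. n \<in> J \<Longrightarrow> A n \<in> sets borel"
  shows "{\<omega> \<in> space M. \<forall>n\<in>J. S' n \<omega> \<in> A n} \<in> events" (is "?E \<in> _")
    and "prob {\<omega> \<in> space M. \<forall>n\<in>J. S' n \<omega> \<in> A n} = (\<Prod>n\<in>J. prob (S' n -` A n \<inter> space M))"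
proof -
  have "?E \<in> events \<and> prob ?E = (\<Prod>n\<in>J. prob (S' n -` A n \<inter> space M))"
  proof (cases "J = {}")
    case True
    then show ?thesis by (simp add: prob_space)
  next
    case False
    have E: "?E = (\<Inter>n\<in>J. S' n -` A n \<inter> space M)" using False by auto
    have "S' n -` A n \<inter> space M \<in> events" if "n \<in> J" for n
      using S'_meas[of n] assms that by (intro measurable_sets) auto
    then have "?E \<in> events" unfolding E using assms(1) False by (intro sets.finite_INT) auto
    moreover have "prob ?E = (\<Prod>n\<in>J. prob (S' n -` A n \<inter> space M))"
      unfolding E using assms False by (intro indep_varsD[OF S'_indep]) auto
    ultimately show ?thesis by simp
  qed
  then show "?E \<in> events" "prob ?E = (\<Prod>n\<in>J. prob (S' n -` A n \<inter> space M))" by auto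
qed

abbreviation N_event :: "real \<Rightarrow> nat \<Rightarrow> 'a set" where
  "N_event t k \<equiv> {\<omega> \<in> space M. counting_process S' t \<omega> = of_nat k}"

lemma N_event_meas: "N_event t k \<in> events"
proof -
  have "counting_process S' t \<in> borel_measurable M"
  proof -
    have "(\<lambda>\<omega>. indicator {\<omega>. S' (Suc n) \<omega> \<le> t} \<omega> :: ennreal) \<in> borel_measurable M" for n
    proof -
      have [measurable]: "S' (Suc n) \<in> borel_measurable M" by (rule S'_meas) simp
      have "(\<lambda>\<omega>. indicator {\<omega>. S' (Suc n) \<omega> \<le> t} \<omega> :: ennreal) = (\<lambda>\<omega>. indicator {..t} (S' (Suc n) \<omega>))"
        by (auto simp: indicator_def)
      then show ?thesis by simp
    qed
    then show ?thesis unfolding counting_process_def[abs_def] by (rule borel_measurable_suminf_order)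
  qed
  then show ?thesis by measurable
qed

text \<open>If the count is \<open>k\<close>, then at least \<open>m - k\<close> of the first \<open>m\<close> partial sums exceed \<open>t\<close>; the crude
  factor \<open>2 ^ m\<close> counts the index sets and is negligible on the scale \<open>exp (t * H t)\<close>.\<close>

lemma prob_count_le: "prob (N_event t k) \<le> 2 ^ m * (\<Prod>n\<in>{k<..m}. q t n)"
proof -
  \<comment> \<open>Candidates for the set of indices up to \<open>m\<close> whose
    \<open>S' n\<close> exceeds \<open>t\<close>; the additive form avoids truncated
    subtraction.\<close>
  define F where "F = {A. A \<subseteq> {1..m} \<and> m \<le> card A + k}"
  define G where "G A = {\<omega> \<in> space M. \<forall>n\<in>A. S' n \<omega> \<in> {t<..}}" for A
  have finF: "finite F" unfolding F_def by (rule finite_subset[of _ "Pow {1..m}"]) auto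
  have finA: "finite A" "A \<subseteq> {1..}" if "A \<in> F" for A
    using that finite_subset[of A "{1..m}"] by (auto simp: F_def)
  have G_meas: "G A \<in> events" if "A \<in> F" for A
    unfolding G_def using finA[OF that] by (intro S'_joint) auto
  have G_prob: "prob (G A) \<le> (\<Prod>n\<in>{k<..m}. q t n)" if "A \<in> F" for A
  proof -
    have "prob (G A) = (\<Prod>n\<in>A. prob (S' n -` {t<..} \<inter> space M))"
      unfolding G_def using finA[OF that] by (intro S'_joint) auto
    also have "\<dots> = (\<Prod>n\<in>A. q t n)" using finA[OF that] by (intro prod.cong S'_gt) auto
    also have "\<dots> \<le> (\<Prod>n\<in>{k<..m}. q t n)"
      using that by (intro prod_le_top_block q_nonneg q_le_1 q_Suc) (auto simp: F_def)
    finally show ?thesis .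
  qed
  have "N_event t k \<subseteq> (\<Union>A\<in>F. G A)"
  proof
    fix \<omega> assume \<omega>: "\<omega> \<in> N_event t k"
    define B where "B = {n \<in> {1..m}. S' n \<omega> \<le> t}"
    have "(of_nat (card B) :: ennreal) = (\<Sum>n\<in>{1..m}. indicator {\<omega>. S' n \<omega> \<le> t} \<omega>)"
      unfolding B_def by (simp add: indicator_def sum.If_cases Int_def)
    also have "\<dots> = (\<Sum>n<m. indicator {\<omega>. S' (Suc n) \<omega> \<le> t} \<omega>)"
      using sum.atLeast1_atMost_eq[of "\<lambda>n. indicator {\<omega>. S' n \<omega> \<le> t} \<omega> :: ennreal" m] by simp
    also have "\<dots> \<le> counting_process S' t \<omega>"
      unfolding counting_process_def by (intro sum_le_suminf) auto
    also have "\<dots> = of_nat k" using \<omega> by simp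
    finally have "card B \<le> k" by simp
    moreover have "card ({1..m} - B) = m - card B" by (subst card_Diff_subset) (auto simp: B_def)
    ultimately have "{1..m} - B \<in> F" unfolding F_def by auto
    moreover have "\<omega> \<in> G ({1..m} - B)" using \<omega> by (auto simp: G_def B_def)
    ultimately show "\<omega> \<in> (\<Union>A\<in>F. G A)" by blast
  qed
  then have "prob (N_event t k) \<le> prob (\<Union>A\<in>F. G A)"
    using G_meas finF by (intro finite_measure_mono sets.finite_UN) auto
  also have "\<dots> \<le> (\<Sum>A\<in>F. prob (G A))"
    by (rule finite_measure_subadditive_finite[OF finF]) (use G_meas in auto)
  also have "\<dots> \<le> (\<Sum>A\<in>F. \<Prod>n\<in>{k<..m}. q t n)" by (intro sum_mono G_prob)
  also have "\<dots> = card F * (\<Prod>n\<in>{k<..m}. q t n)" by simp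
  also have "\<dots> \<le> 2 ^ m * (\<Prod>n\<in>{k<..m}. q t n)"
  proof (rule mult_right_mono)
    have "card F \<le> card (Pow {1..m})" unfolding F_def by (intro card_mono) auto
    also have "\<dots> = 2 ^ m" by (simp add: card_Pow)
    finally show "real (card F) \<le> 2 ^ m" by (simp flip: of_nat_le_iff)
  qed (auto intro: prod_nonneg q_nonneg)
  finally show ?thesis .
qed

text \<open>The scenario is that the first \<open>k\<close> variables are at most \<open>t\<close>
  and all later ones exceed it. Monotonicity of \<open>q\<close> bounds the first \<open>k\<close>
  factors, and the product over \<open>n > m\<close> is at least \<open>1 / 2\<close>.\<close>

lemma prob_count_ge:
  assumes km: "k \<le> m"
    and tail: "\<And>K. m \<le> K \<Longrightarrow> (\<Sum>n\<in>{m<..K}. 1 - q t n) \<le> 1 / 2"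
  shows "(1 - q t k) ^ k * (\<Prod>n\<in>{k<..m}. q t n) * (1 / 2) \<le> prob (N_event t k)"
proof -
  let ?c = "(1 - q t k) ^ k * (\<Prod>n\<in>{k<..m}. q t n) * (1 / 2)"
  define A where "A n = (if n \<le> k then {..t} else {t<..})" for n :: nat
  define G where "G K = {\<omega> \<in> space M. \<forall>n\<in>{1..K}. S' n \<omega> \<in> A n}" for K
  have A_sets: "A n \<in> sets borel" for n by (simp add: A_def)
  have G_meas: "G K \<in> events" for K unfolding G_def using A_sets by (intro S'_joint) auto
  have G_ge: "?c \<le> prob (G K)" if K: "m \<le> K" for K
  proof -
    have split: "{1..K} = {1..k} \<union> {k<..m} \<union> {m<..K}" using km K by auto
    have "prob (G K) = (\<Prod>n\<in>{1..K}. prob (S' n -` A n \<inter> space M))"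
      unfolding G_def using A_sets by (intro S'_joint) auto
    also have "\<dots> = (\<Prod>n\<in>{1..K}. if n \<le> k then 1 - q t n else q t n)"
      by (intro prod.cong) (auto simp: A_def S'_gt S'_le)
    also have "\<dots> = (\<Prod>n\<in>{1..k}. 1 - q t n) * (\<Prod>n\<in>{k<..m}. q t n) * (\<Prod>n\<in>{m<..K}. q t n)"
      unfolding split using km by (subst prod.union_disjoint; (subst prod.union_disjoint)?) auto
    also have "\<dots> \<ge> ?c"
    proof (intro mult_mono)
      have "(\<Prod>n\<in>{1..k}. 1 - q t k) \<le> (\<Prod>n\<in>{1..k}. 1 - q t n)"
        using q_mono[of _ k t] q_le_1 by (intro prod_mono) auto
      then show "(1 - q t k) ^ k \<le> (\<Prod>n\<in>{1..k}. 1 - q t n)" by simp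
      have "1 - (\<Sum>n\<in>{m<..K}. 1 - q t n) \<le> (\<Prod>n\<in>{m<..K}. q t n)"
        by (intro prod_ge_one_minus_sum q_nonneg q_le_1) auto
      then show "1 / 2 \<le> (\<Prod>n\<in>{m<..K}. q t n)" using tail[OF K] by linarith
    qed (auto intro!: prod_nonneg mult_nonneg_nonneg zero_le_power simp: q_nonneg q_le_1)
    finally show ?thesis .
  qed
  \<comment> \<open>The bound is uniform in \<open>K\<close>, so continuity from above imposes the
    infinitely many constraints at once.\<close>
  have "(\<lambda>K. prob (G K)) \<longlonglongrightarrow> prob (\<Inter>K. G K)"
    using G_meas by (intro finite_Lim_measure_decseq) (auto simp: G_def decseq_def)
  then have "?c \<le> prob (\<Inter>K. G K)"
    using G_ge by (intro LIMSEQ_le_const) auto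
  also have "\<dots> \<le> prob (N_event t k)"
  proof (intro finite_measure_mono N_event_meas subsetI)
    fix \<omega> assume \<omega>: "\<omega> \<in> (\<Inter>K. G K)"
    have "S' (Suc n) \<omega> \<le> t \<longleftrightarrow> n < k" for n
    proof -
      have "\<omega> \<in> G (Suc n)" using \<omega> by blast
      then have "S' (Suc n) \<omega> \<in> A (Suc n)" by (simp add: G_def)
      then show ?thesis by (simp add: A_def Suc_le_eq split: if_splits)
    qed
    then have "counting_process S' t \<omega> = (\<Sum>n. of_bool (n < k))"
      unfolding counting_process_def by (simp add: indicator_def)
    also have "\<dots> = (\<Sum>n<k. of_bool (n < k))" by (intro suminf_finite) auto
    finally have "counting_process S' t \<omega> = of_nat k" by simp
    then show "\<omega> \<in> N_event t k" using \<omega> by (auto simp: G_def)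
  qed
  finally show ?thesis .
qed

section \<open>Logarithmic asymptotics of the decoupled count\<close>

lemma prod_q:
  "(\<Prod>n\<in>{idx b t<..idx 2 t}. q t n) = exp (- cost_sum b t)"
  unfolding cost_sum_def sum_negf minus_minus
  by (subst exp_sum) (auto intro!: prod.cong simp: q_pos)

text \<open>With \<open>m = idx 2 t\<close>, the upper bound loses the factor \<open>2 ^ m\<close>.
  The lower bound loses at most \<open>2 ^ (m + 1)\<close>, from
  \<open>1 - q t k \<ge> 1 / 2\<close> and the tail product.\<close>

lemma count_cost_bounds:
  assumes b: "0 < b" "b < 1"
  shows "\<forall>\<^sub>F t in at_top. \<bar>- ln (prob (N_event t (idx b t))) - cost_sum b t\<bar> \<le> ln 2 * (real (idx 2 t) + 1)"
proof -
  \<comment> \<open>The slope \<open>\<mu> / 2\<close> matches the cutoff: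
    \<open>n > idx 2 t\<close> gives \<open>t \<le> \<mu> / 2 * n\<close>.\<close>
  obtain r where r: "0 < r" "r < 1" "\<And>n. prob {\<omega> \<in> space M. S n \<omega> \<le> \<mu> / 2 * n} \<le> r ^ n"
    using lower_tail[of "\<mu> / 2"] mu_pos by auto
  have "(\<lambda>n. r ^ n * r / (1 - r)) \<longlonglongrightarrow> 0 * r / (1 - r)"
    using r by (intro tendsto_intros LIMSEQ_realpow_zero) auto
  then have "\<forall>\<^sub>F n in sequentially. r ^ n * r / (1 - r) < 1 / 2"
    by (intro order_tendstoD(2)) auto
  then have "\<forall>\<^sub>F t in at_top. r ^ (idx 2 t) * r / (1 - r) < 1 / 2"
    using idx_at_top[of 2] by (auto simp: filterlim_iff)
  \<comment> \<open>Half the limiting constant is enough to push the cost at \<open>idx b t\<close>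
    above \<open>ln 2\<close>, that is, \<open>q\<close> below \<open>1 / 2\<close>.\<close>
  moreover have "\<forall>\<^sub>F t in at_top. (1 - b) powr \<rho> / 2 * H t < - ln (q t (idx b t))"
    using b by (intro cost_lower) auto
  moreover have "\<forall>\<^sub>F t in at_top. H t \<ge> ln 2 / ((1 - b) powr \<rho> / 2)"
    using H_at_top by (auto simp: filterlim_at_top)
  moreover have "\<forall>\<^sub>F t in at_top. 1 \<le> idx b t"
    using idx_at_top[OF b(1)] by (auto simp: filterlim_at_top)
  ultimately show ?thesis
    using eventually_ge_at_top[of 0]
  proof eventually_elim
    case (elim t)
    define k where "k = idx b t"
    define m where "m = idx 2 t"
    have km: "k \<le> m" unfolding k_def m_def using elim(5) b by (intro idx_mono) auto
    have k1: "1 \<le> k" using elim(4) by (simp add: k_def)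
    have prodq: "(\<Prod>n\<in>{k<..m}. q t n) = exp (- cost_sum b t)" by (simp add: k_def m_def prod_q)
    have qk: "q t k \<le> 1 / 2"
    proof -
      have "ln 2 \<le> (1 - b) powr \<rho> / 2 * H t" using elim(3) b by (simp add: field_simps)
      then have "ln (q t k) \<le> ln (1 / 2)" using elim(2) by (simp add: ln_div k_def)
      then show ?thesis using q_pos[OF k1, of t] by (subst (asm) ln_le_cancel_iff) auto
    qed
    have "(\<Sum>n\<in>{m<..K}. 1 - q t n) \<le> 1 / 2" for K
    proof -
      have "(\<Sum>n\<in>{m<..K}. 1 - q t n) \<le> (\<Sum>n\<in>{m<..K}. r ^ n)"
      proof (intro sum_mono one_minus_q_le[OF r(3)])
        fix n assume "n \<in> {m<..K}"
        then have "2 * t / \<mu> \<le> real n" using idx_bounds(2)[of 2 t] elim(5) by (auto simp: m_def)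
        then show "t \<le> \<mu> / 2 * n" using mu_pos by (simp add: field_simps)
      qed
      also have "\<dots> \<le> r ^ Suc m / (1 - r)"
      proof -
        have "{m<..K} = {Suc m..K}" by auto
        then show ?thesis using r by (cases "K < Suc m") (auto simp: sum_gp divide_right_mono)
      qed
      also have "\<dots> \<le> 1 / 2" using elim(1) by (simp add: m_def mult.commute)
      finally show ?thesis .
    qed
    then have "(1 - q t k) ^ k * exp (- cost_sum b t) * (1 / 2) \<le> prob (N_event t k)"
      using prob_count_ge[OF km, of t] unfolding prodq by blast
    then have "(1 / 2) ^ m * exp (- cost_sum b t) * (1 / 2) \<le> prob (N_event t k)"
    proof (rule order_trans[rotated])
      have "(1 / 2 :: real) ^ m \<le> (1 / 2) ^ k" using km by (intro power_decreasing) auto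
      also have "\<dots> \<le> (1 - q t k) ^ k" using qk by (intro power_mono) auto
      finally show "(1 / 2) ^ m * exp (- cost_sum b t) * (1 / 2)
        \<le> (1 - q t k) ^ k * exp (- cost_sum b t) * (1 / 2)"
        by (intro mult_right_mono) auto
    qed
    then have lower: "exp (- cost_sum b t) * (1 / 2) ^ (m + 1) \<le> prob (N_event t k)"
      by (simp add: mult_ac)
    then have pos: "0 < prob (N_event t k)" by (rule less_le_trans[rotated]) simp
    have "ln (exp (- cost_sum b t) * (1 / 2) ^ (m + 1)) \<le> ln (prob (N_event t k))"
      using lower pos by (subst ln_le_cancel_iff) auto
    moreover have "ln (exp (- cost_sum b t) * (1 / 2) ^ (m + 1)) = - cost_sum b t - ln 2 * (real m + 1)"
      by (subst ln_mult) (auto simp: ln_div ln_realpow algebra_simps simp del: power_Suc)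
    moreover have "ln (prob (N_event t k)) \<le> ln (2 ^ m * exp (- cost_sum b t))"
      using pos prob_count_le[of t k m] unfolding prodq by (subst ln_le_cancel_iff) auto
    moreover have "ln (2 ^ m * exp (- cost_sum b t)) = ln 2 * m - cost_sum b t"
      by (subst ln_mult) (auto simp: ln_realpow)
    moreover have "ln 2 * (real m + 1) = ln 2 * real m + ln 2" "(0::real) \<le> ln 2"
      by (auto simp: algebra_simps)
    ultimately have "\<bar>- ln (prob (N_event t k)) - cost_sum b t\<bar> \<le> ln 2 * (real m + 1)"
      by linarith
    then show ?case by (simp add: k_def m_def)
  qed
qed

text \<open>The error in \<open>count_cost_bounds\<close> is of order \<open>t\<close>, hence
  vanishes after division by \<open>t * H t\<close>.\<close>

lemma count_tendsto:
  assumes b: "0 < b" "b < 1"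
  shows "((\<lambda>t. - ln (prob (N_event t (idx b t))) / (t * H t))
    \<longlongrightarrow> (1 - b) powr (\<rho> + 1) / (\<mu> * (\<rho> + 1))) at_top"
proof -
  let ?d = "\<lambda>t. - ln (prob (N_event t (idx b t))) / (t * H t) - cost_sum b t / (t * H t)"
  have "(?d \<longlongrightarrow> 0) at_top"
  proof (rule Lim_null_comparison)
    show "\<forall>\<^sub>F t in at_top. norm (?d t) \<le> ln 2 * (2 / \<mu> + 1) / H t"
      using count_cost_bounds[OF b] H_pos eventually_ge_at_top[of 1]
    proof eventually_elim
      case (elim t)
      have "real (idx 2 t) + 1 \<le> 2 * t / \<mu> + t" using idx_bounds(1)[of 2 t] elim(3) by simp
      also have "\<dots> = (2 / \<mu> + 1) * t" by (simp add: algebra_simps)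
      finally have "ln 2 * (real (idx 2 t) + 1) \<le> ln 2 * ((2 / \<mu> + 1) * t)" by (intro mult_left_mono) auto
      from order_trans[OF elim(1) this]
      have "\<bar>- ln (prob (N_event t (idx b t))) - cost_sum b t\<bar> \<le> ln 2 * (2 / \<mu> + 1) * t"
        by (simp only: mult.assoc)
      then have "\<bar>- ln (prob (N_event t (idx b t))) - cost_sum b t\<bar> / (t * H t)
          \<le> ln 2 * (2 / \<mu> + 1) * t / (t * H t)"
        using elim by (intro divide_right_mono) auto
      moreover have "norm (?d t) = \<bar>- ln (prob (N_event t (idx b t))) - cost_sum b t\<bar> / (t * H t)"
        unfolding diff_divide_distrib[symmetric] using elim by (simp add: abs_divide abs_mult)
      ultimately show ?case using elim by simp
    qed
    show "((\<lambda>t. ln 2 * (2 / \<mu> + 1) / H t) \<longlongrightarrow> 0) at_top"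
      by (intro tendsto_divide_0[OF tendsto_const] filterlim_at_top_imp_at_infinity H_at_top)
  qed
  from tendsto_add[OF this cost_sum_tendsto[OF b]] show ?thesis by simp
qed

end

section \<open>From the slowly varying tail to monotone regular growth\<close>

theorem theorem3:
  fixes M :: "'a measure" and \<xi> :: "'a \<Rightarrow> real"
    and X S' :: "nat \<Rightarrow> 'a \<Rightarrow> real"
    and H l :: "real \<Rightarrow> real" and b \<rho> \<mu> :: real
  assumes "prob_space M"
    and "\<xi> \<in> borel_measurable M"
    and "AE \<omega> in M. 0 \<le> \<xi> \<omega>"
    and "\<nexists>c. AE \<omega> in M. \<xi> \<omega> = c"
    and "iid_copies M \<xi> X"
    and "decoupled M (random_walk X) S'"
    and "0 < b" "b < 1"
    and "0 < \<rho>" "\<rho> < 1"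
    and "slowly_varying l"
    and "H = neg_log_tail M \<xi>"
    and "\<And>t. 0 < t \<Longrightarrow> H t = t powr \<rho> * l t"
    and "\<And>v :: real \<Rightarrow> real. v \<in> o[at_top](\<lambda>t. t) \<Longrightarrow>
           \<exists>r1 r2. r1 \<in> o[at_top](\<lambda>t. v t / t * H t) \<and> r2 \<in> o[at_top](\<lambda>_. 1) \<and>
             (\<forall>\<^sub>F t in at_top. H (t + v t) - H t = \<rho> * (v t / t) * H t + r1 t + r2 t)"
    and "\<mu> = (LINT \<omega>|M. \<xi> \<omega>)"
  shows "integrable M \<xi> \<and>
    ((\<lambda>t. - ln (measure M {\<omega> \<in> space M.
                  counting_process S' t \<omega> = of_nat (nat \<lfloor>b * t / \<mu>\<rfloor>)})
            / (t powr (\<rho> + 1) * l t))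
      \<longlongrightarrow> (1 - b) powr (\<rho> + 1) / (\<mu> * (\<rho> + 1))) at_top"
proof -
  interpret prob_space M by fact
  note H_form = assms(13)
  obtain A where l_pos: "\<And>t. A \<le> t \<Longrightarrow> 0 < l t"
    and l_ratio: "\<And>c. 0 < c \<Longrightarrow> ((\<lambda>t. l (c * t) / l t) \<longlongrightarrow> 1) at_top"
    using \<open>slowly_varying l\<close> by (auto simp: slowly_varying_def)
  have H_pos: "0 < H t" if "max A 1 \<le> t" for t
    using H_form[of t] l_pos[of t] that by simp
  have H_ln: "H t = - ln (prob {\<omega> \<in> space M. t < \<xi> \<omega>})" for t
    using \<open>H = neg_log_tail M \<xi>\<close> by (simp add: neg_log_tail_def)
  have tail_anti: "prob {\<omega> \<in> space M. y < \<xi> \<omega>} \<le> prob {\<omega> \<in> space M. x < \<xi> \<omega>}" if "x \<le> y" for x y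
    using that \<open>\<xi> \<in> borel_measurable M\<close> by (intro finite_measure_mono) auto
  have tail_pos: "0 < prob {\<omega> \<in> space M. t < \<xi> \<omega>}" for t
  proof -
    let ?u = "max t (max A 1)"
    \<comment> \<open>A vanishing tail at \<open>?u\<close> would give \<open>H ?u = 0\<close> by
      \<open>ln 0 = 0\<close>, against positivity of \<open>H\<close> there. Monotonicity carries
      positivity of the tail back to \<open>t\<close>.\<close>
    have "prob {\<omega> \<in> space M. ?u < \<xi> \<omega>} \<noteq> 0" using H_pos[of ?u] H_ln[of ?u] by auto
    then have "0 < prob {\<omega> \<in> space M. ?u < \<xi> \<omega>}" by (simp add: zero_less_measure_iff)
    then show ?thesis using tail_anti[of t ?u] by simp
  qed
  have "mono H"
    using tail_anti tail_pos by (auto simp: mono_def H_ln)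
  moreover have "((\<lambda>t. H (c * t) / H t) \<longlongrightarrow> c powr \<rho>) at_top" if "0 < c" for c
  proof (rule Lim_transform_eventually)
    show "((\<lambda>t. c powr \<rho> * (l (c * t) / l t)) \<longlongrightarrow> c powr \<rho>) at_top"
      using tendsto_mult_left[OF l_ratio[OF that], of "c powr \<rho>"] by simp
    show "\<forall>\<^sub>F t in at_top. c powr \<rho> * (l (c * t) / l t) = H (c * t) / H t"
      using eventually_gt_at_top[of 0]
      by eventually_elim (use that in \<open>simp add: H_form powr_mult\<close>)
  qed
  moreover have "\<forall>\<^sub>F t in at_top. 0 < H t"
    using eventually_ge_at_top[of "max A 1"] by eventually_elim (rule H_pos)
  ultimately interpret W: decoupled_walk M H \<rho> \<xi> X S'
    using assms tail_pos H_ln by unfold_locales auto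
  have mu: "\<mu> = W.\<mu>" using assms(15) by (simp add: W.\<mu>_def)
  have "\<forall>\<^sub>F t in at_top. t * H t = t powr (\<rho> + 1) * l t"
    using eventually_gt_at_top[of 0] by eventually_elim (simp add: H_form powr_add)
  then have "\<forall>\<^sub>F t in at_top. - ln (prob (W.N_event t (W.idx b t))) / (t * H t)
    = - ln (prob (W.N_event t (W.idx b t))) / (t powr (\<rho> + 1) * l t)"
    by eventually_elim simp
  from Lim_transform_eventually[OF W.count_tendsto[OF \<open>0 < b\<close> \<open>b < 1\<close>] this] W.xi_integrable
  show ?thesis unfolding mu by simp
qed

end
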